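(* Let $d\ge1$, fix $k\ge1$ and let $L_1,\ldots,L_k$ be independent (homogeneous) Poisson point processes on $\mathbb{R}^d$, each with intensity in $(0,\infty)$. Consider a game of $k$-pond friendly frogs on $L_1,\dots,L_k$, in which Alice first places two frogs in each of $L_1,\ldots,L_{k-1}$ and one frog in $L_k$, then Bob places the final frog in $L_k$, and Alice moves next. With probability $1$, Bob wins (that is, Bob has a winning strategy).
   Context: Distances are Euclidean. The realization of each Poisson process is regarded as a random (countable) set of points; the players know these realizations. In a position of $k$-pond friendly frogs, each set $L_i$ (regarded as a separate pond) has two frogs located at two distinct points of $L_i$; in particular the opening placements must put the two frogs in each $L_i$ at distinct points. The players take turns. A move consists of choosing one $i$ and moving one of the two frogs in $L_i$ (both players may move any frog) to a different point in the same set $L_i$, so that the distance between the two frogs in $L_i$ strictly decreases and they do not occupy the same point. A player loses if, on their turn, they have no legal move in any of the sets $L_i$; the other player then wins. A strategy for a player assigns a legal move (if one exists) to each position; a winning strategy is one that results in a win for that player whatever strategy the other player uses. *)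

theory Defs
  imports "HOL-Probability.Probability"
begin

section \<open>Poisson point processes\<close>

definition locally_finite_sets :: "'a::euclidean_space set set" where
  "locally_finite_sets = {S. \<forall>B. bounded B \<longrightarrow> finite (S \<inter> B)}"

text \<open>The usual \<open>\<sigma>\<close>-algebra on simple locally finite configurations, generated by
  the counts of points in bounded Borel sets.\<close>

definition configuration_space :: "'a::euclidean_space set measure" where
  "configuration_space = sigma locally_finite_sets
     {{S \<in> locally_finite_sets. card (S \<inter> B) = n} | B n. B \<in> sets borel \<and> bounded B}"

text \<open>The Poisson weights are written out because the mean may be \<open>0\<close>, which
  \<open>poisson_pmf\<close> does not admit.\<close>

definition poisson_process ::
  "'w measure \<Rightarrow> real \<Rightarrow> ('w \<Rightarrow> 'a::euclidean_space set) \<Rightarrow> bool" where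
  "poisson_process M r X \<longleftrightarrow>
     X \<in> measurable M configuration_space \<and>
     (\<forall>B n. B \<in> sets borel \<and> bounded B \<longrightarrow>
        measure M {w \<in> space M. card (X w \<inter> B) = n} =
          (r * measure lborel B) ^ n / fact n * exp (- (r * measure lborel B))) \<and>
     (\<forall>(J :: nat set) B. finite J \<and> disjoint_family_on B J \<and>
        (\<forall>j\<in>J. B j \<in> sets borel \<and> bounded (B j)) \<longrightarrow>
        prob_space.indep_vars M (\<lambda>_. count_space UNIV) (\<lambda>j w. card (X w \<inter> B j)) J)"


section \<open>Friendly frogs in several ponds\<close>

text \<open>The ponds are \<open>L 1, \<dots>, L k\<close>; a position records the locations of the (labelled)
  two frogs in each of them.\<close>

type_synonym 'a position = "nat \<Rightarrow> 'a \<times> 'a"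

definition frog_pairs :: "'a set \<Rightarrow> ('a \<times> 'a) set" where
  "frog_pairs S = {(x, y). x \<in> S \<and> y \<in> S \<and> x \<noteq> y}"

definition positions :: "nat \<Rightarrow> (nat \<Rightarrow> 'a set) \<Rightarrow> 'a position set" where
  "positions k L = (\<Pi>\<^sub>E i\<in>{1..k}. frog_pairs (L i))"

definition legal_move ::
  "nat \<Rightarrow> (nat \<Rightarrow> 'a::metric_space set) \<Rightarrow> 'a position \<Rightarrow> 'a position \<Rightarrow> bool" where
  "legal_move k L P Q \<longleftrightarrow>
     P \<in> positions k L \<and>
     (\<exists>i\<in>{1..k}. \<exists>x y. \<exists>z\<in>L i. P i = (x, y) \<and>
        (z \<noteq> x \<and> z \<noteq> y \<and> dist z y < dist x y \<and> Q = P(i := (z, y)) \<or>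
         z \<noteq> x \<and> z \<noteq> y \<and> dist x z < dist x y \<and> Q = P(i := (x, z))))"

definition stuck :: "nat \<Rightarrow> (nat \<Rightarrow> 'a::metric_space set) \<Rightarrow> 'a position \<Rightarrow> bool" where
  "stuck k L P \<longleftrightarrow> (\<nexists>Q. legal_move k L P Q)"

definition strategy ::
  "nat \<Rightarrow> (nat \<Rightarrow> 'a::metric_space set) \<Rightarrow> ('a position \<Rightarrow> 'a position) \<Rightarrow> bool" where
  "strategy k L \<sigma> \<longleftrightarrow> (\<forall>P\<in>positions k L. \<not> stuck k L P \<longrightarrow> legal_move k L P (\<sigma> P))"

text \<open>\<open>play \<alpha> \<beta> P n\<close> is the position after \<open>n\<close> moves from \<open>P\<close>, where Alice moves first and
  follows \<open>\<alpha>\<close>, and Bob follows \<open>\<beta>\<close>. Its values are only meaningful up to the first stuck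
  position. An unending play is won by neither player.\<close>

fun play ::
  "('a position \<Rightarrow> 'a position) \<Rightarrow> ('a position \<Rightarrow> 'a position) \<Rightarrow> 'a position \<Rightarrow> nat \<Rightarrow> 'a position"
where
  "play \<alpha> \<beta> P 0 = P"
| "play \<alpha> \<beta> P (Suc n) = (if even n then \<alpha> else \<beta>) (play \<alpha> \<beta> P n)"

definition won_by_Bob ::
  "nat \<Rightarrow> (nat \<Rightarrow> 'a::metric_space set) \<Rightarrow> (nat \<Rightarrow> 'a position) \<Rightarrow> bool" where
  "won_by_Bob k L p \<longleftrightarrow> (\<exists>n. even n \<and> stuck k L (p n) \<and> (\<forall>m<n. \<not> stuck k L (p m)))"

text \<open>Alice's opening \<open>(P, x)\<close> consists of her frogs in the first \<open>k - 1\<close> ponds and her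
  single frog in the last one.\<close>

definition openings :: "nat \<Rightarrow> (nat \<Rightarrow> 'a set) \<Rightarrow> ('a position \<times> 'a) set" where
  "openings k L = (\<Pi>\<^sub>E i\<in>{1..<k}. frog_pairs (L i)) \<times> L k"

text \<open>A strategy for Bob is a placement rule \<open>b\<close> together with a strategy \<open>\<beta>\<close> for the moves;
  a strategy for Alice is an opening together with a strategy \<open>\<alpha>\<close> for the moves.\<close>

definition Bob_wins :: "nat \<Rightarrow> (nat \<Rightarrow> 'a::metric_space set) \<Rightarrow> bool" where
  "Bob_wins k L \<longleftrightarrow>
     (\<exists>b \<beta>. (\<forall>(P, x)\<in>openings k L. b (P, x) \<in> L k \<and> b (P, x) \<noteq> x) \<and> strategy k L \<beta> \<and>
        (\<forall>(P, x)\<in>openings k L. \<forall>\<alpha>. strategy k L \<alpha> \<longrightarrow>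
           won_by_Bob k L (play \<alpha> \<beta> (P(k := (x, b (P, x)))))))"

end

theory Submission
  imports Defs "HOL-Library.Transitive_Closure_Table"
begin

text \<open>Bob answers so that the Grundy value of the game on the first \<open>k - 1\<close> ponds equals the Grundy
  value of the last pond; by Sprague--Grundy he can maintain this balance and so never gets stuck
  first. To reach it when placing the last frog, he needs for every \<open>x\<close> in the last pond and every
  \<open>j\<close> a point \<open>y\<close> such that the position \<open>(x, y)\<close> has Grundy value \<open>j\<close>. Call \<open>x\<close> unmatched at
  level \<open>j\<close> if there is no such \<open>y\<close>. Two points unmatched at level \<open>j\<close> form a pair of Grundy
  value less than \<open>j\<close>, because a larger value would allow a move of one frog to a position of value
  \<open>j\<close>; and the pairs of a given value at \<open>x\<close> all have the same length. So a locally finite set has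
  only finitely many unmatched points. A translation invariant random set that is almost surely
  finite is almost surely empty, as the probability that it meets a ball does not change when the
  ball moves to infinity.

  The game ends because a Poisson process has no infinite descending chains: the lengths along
  such a chain would decrease to a limit \<open>l\<close>, and joining points at distance close to \<open>l\<close> gives
  mean degree less than one, hence only finite clusters.\<close>

section \<open>Grundy values\<close>

text \<open>Rounds of the mex rule started from the constant 0. This makes sense for every relation,
  and round \<open>n + 1\<close> refers only to round \<open>n\<close>, so properties of the values
  can be proved by induction on the round even where plays do not end.\<close>

primrec grundy_approx :: "('p \<Rightarrow> 'p \<Rightarrow> bool) \<Rightarrow> nat \<Rightarrow> 'p \<Rightarrow> nat" where
  "grundy_approx step 0 p = 0"
| "grundy_approx step (Suc n) p = (LEAST j. \<forall>q. step p q \<longrightarrow> grundy_approx step n q \<noteq> j)"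

definition short_game :: "('p \<Rightarrow> 'p \<Rightarrow> bool) \<Rightarrow> bool" where
  "short_game step \<longleftrightarrow> wf {(q, p). step p q} \<and> (\<forall>p. finite {q. step p q})"

text \<open>The value at which the approximants settle at \<open>p\<close>; it is arbitrary where
  they never settle.\<close>

definition grundy :: "('p \<Rightarrow> 'p \<Rightarrow> bool) \<Rightarrow> 'p \<Rightarrow> nat" where
  "grundy step p = (THE j. \<forall>\<^sub>F n in sequentially. grundy_approx step n p = j)"

lemma grundy_eqI:
  assumes "\<forall>\<^sub>F n in sequentially. grundy_approx step n p = j"
  shows "grundy step p = j"
  unfolding grundy_def
proof (rule the_equality, rule assms)
  fix i assume "\<forall>\<^sub>F n in sequentially. grundy_approx step n p = i"
  with assms have "\<forall>\<^sub>F n in sequentially. i = j"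
    by eventually_elim simp
  then show "i = j" by simp
qed

text \<open>Finitely many options have a common round after which all their values are final; one
  round later the value of \<open>p\<close> is the mex of these.\<close>

lemma eventually_grundy_approx_mex:
  assumes "finite {q. step p q}"
    and "\<And>q. step p q \<Longrightarrow> \<forall>\<^sub>F n in sequentially. grundy_approx step n q = grundy step q"
  shows "\<forall>\<^sub>F n in sequentially.
    grundy_approx step n p = (LEAST j. \<forall>q. step p q \<longrightarrow> grundy step q \<noteq> j)"
proof -
  have "\<forall>\<^sub>F n in sequentially. \<forall>q\<in>{q. step p q}. grundy_approx step n q = grundy step q"
    by (rule eventually_ball_finite) (use assms in auto)
  then have "\<forall>\<^sub>F n in sequentially.
      grundy_approx step (Suc n) p = (LEAST j. \<forall>q. step p q \<longrightarrow> grundy step q \<noteq> j)"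
  proof eventually_elim
    case (elim n)
    then have "(\<forall>q. step p q \<longrightarrow> grundy_approx step n q \<noteq> j) \<longleftrightarrow>
        (\<forall>q. step p q \<longrightarrow> grundy step q \<noteq> j)" for j
      by auto
    then show ?case by simp
  qed
  then show ?thesis
    unfolding eventually_sequentially_Suc[of "\<lambda>n. grundy_approx step n p = _"] .
qed

lemma eventually_grundy_approx:
  assumes "short_game step"
  shows "\<forall>\<^sub>F n in sequentially. grundy_approx step n p = grundy step p"
proof -
  have "wf {(q, p). step p q}" using assms by (simp add: short_game_def)
  then show ?thesis
  proof (induction p rule: wf_induct_rule)
    case (less p)
    have "\<forall>\<^sub>F n in sequentially.
        grundy_approx step n p = (LEAST j. \<forall>q. step p q \<longrightarrow> grundy step q \<noteq> j)"
      by (rule eventually_grundy_approx_mex) (use assms less in \<open>auto simp: short_game_def\<close>)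
    then show ?case using grundy_eqI by metis
  qed
qed

lemma grundy_eq_mex:
  assumes "short_game step"
  shows "grundy step p = (LEAST j. \<forall>q. step p q \<longrightarrow> grundy step q \<noteq> j)"
  by (rule grundy_eqI, rule eventually_grundy_approx_mex)
    (use assms in \<open>auto simp: short_game_def intro: eventually_grundy_approx[OF assms]\<close>)

lemma grundy_step_neq:
  assumes "short_game step" "step p q"
  shows "grundy step q \<noteq> grundy step p"
proof -
  \<comment> \<open>Finitely many options leave some number free, so the \<open>LEAST\<close> in the
    mex rule is attained and not a default.\<close>
  have "finite (grundy step ` {q. step p q})" using assms(1) by (simp add: short_game_def)
  then obtain j where "j \<notin> grundy step ` {q. step p q}" using ex_new_if_finite[OF infinite_UNIV_nat] by blast
  then have "\<forall>q. step p q \<longrightarrow> grundy step q \<noteq> j" by blast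
  from LeastI[of "\<lambda>j. \<forall>q. step p q \<longrightarrow> grundy step q \<noteq> j", OF this]
  have "\<forall>q. step p q \<longrightarrow> grundy step q \<noteq> grundy step p"
    unfolding grundy_eq_mex[OF assms(1), of p] .
  then show ?thesis using assms(2) by blast
qed

lemma grundy_less_obtains:
  assumes "short_game step" "j < grundy step p"
  obtains q where "step p q" "grundy step q = j"
proof -
  have "\<not> (\<forall>q. step p q \<longrightarrow> grundy step q \<noteq> j)"
    using not_less_Least[OF assms(2)[unfolded grundy_eq_mex[OF assms(1), of p]]] .
  then show ?thesis using that by blast
qed

text \<open>The rank counts the nonempty sequences of moves from \<open>p\<close>: each starts with
  a move to some \<open>q\<close> and either stops or goes on from \<open>q\<close>. Natural ranks,
  unlike mere well-foundedness, can be added over several ponds.\<close>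

lemma short_game_rank:
  assumes "short_game step"
  obtains f :: "'p \<Rightarrow> nat" where "\<And>p q. step p q \<Longrightarrow> f q < f p"
proof -
  define R where "R = {(q, p). step p q}"
  define f :: "'p \<Rightarrow> nat" where "f = wfrec R (\<lambda>f p. \<Sum>q\<in>{q. step p q}. Suc (f q))"
  have wf: "wf R" using assms by (simp add: short_game_def R_def)
  have f: "f p = (\<Sum>q\<in>{q. step p q}. Suc (f q))" for p
    by (subst f_def, subst wfrec[OF wf], fold f_def, rule sum.cong) (auto simp: cut_def R_def)
  have "f q < f p" if "step p q" for p q
  proof -
    have "Suc (f q) \<le> (\<Sum>q\<in>{q. step p q}. Suc (f q))"
      using assms that by (intro member_le_sum) (auto simp: short_game_def)
    then show ?thesis using f[of p] by simp
  qed
  then show ?thesis by (rule that)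
qed

lemma short_gameI:
  fixes f :: "'p \<Rightarrow> nat"
  assumes "\<And>p q. step p q \<Longrightarrow> f q < f p" "\<And>p. finite {q. step p q}"
  shows "short_game step"
proof -
  have "wf {(q, p). step p q}"
    by (rule wf_subset[OF wf_measure[of f]]) (use assms(1) in auto)
  then show ?thesis using assms(2) by (simp add: short_game_def)
qed

section \<open>Balancing the ponds\<close>

text \<open>The game in a single pond. Pairs outside \<open>frog_pairs S\<close> are dead ends, so
  the relation is defined on all pairs but only genuine positions matter for its plays.\<close>

definition pond_move :: "'a::metric_space set \<Rightarrow> 'a \<times> 'a \<Rightarrow> 'a \<times> 'a \<Rightarrow> bool" where
  "pond_move S p q \<longleftrightarrow> p \<in> frog_pairs S \<and>
     (\<exists>z\<in>S. z \<noteq> fst p \<and> z \<noteq> snd p \<and>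
        (dist z (snd p) < dist (fst p) (snd p) \<and> q = (z, snd p) \<or>
         dist (fst p) z < dist (fst p) (snd p) \<and> q = (fst p, z)))"

lemma pond_move_frog_pairs:
  assumes "pond_move S p q" shows "p \<in> frog_pairs S" "q \<in> frog_pairs S"
  using assms by (auto simp: pond_move_def frog_pairs_def)

lemma legal_move_iff:
  "legal_move k L P Q \<longleftrightarrow>
     P \<in> positions k L \<and> (\<exists>i\<in>{1..k}. \<exists>q. pond_move (L i) (P i) q \<and> Q = P(i := q))" (is "?l \<longleftrightarrow> ?r")
proof
  assume ?l
  then obtain i x y z where *: "P \<in> positions k L" "i \<in> {1..k}" "z \<in> L i" "P i = (x, y)" "z \<noteq> x" "z \<noteq> y"
     "dist z y < dist x y \<and> Q = P(i := (z, y)) \<or> dist x z < dist x y \<and> Q = P(i := (x, z))"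
    unfolding legal_move_def by blast
  then have "P i \<in> frog_pairs (L i)" using PiE_mem unfolding positions_def by metis
  with * have "\<exists>q. pond_move (L i) (P i) q \<and> Q = P(i := q)"
    unfolding pond_move_def by auto
  with * show ?r by blast
next
  assume ?r
  then obtain i q where *: "P \<in> positions k L" "i \<in> {1..k}" "pond_move (L i) (P i) q" "Q = P(i := q)"
    by blast
  obtain x y where xy: "P i = (x, y)" by fastforce
  show ?l using * xy unfolding legal_move_def pond_move_def by fastforce
qed

lemma legal_move_positions:
  assumes "legal_move k L P Q" shows "P \<in> positions k L" "Q \<in> positions k L"
proof -
  obtain i q where *: "P \<in> positions k L" "i \<in> {1..k}" "pond_move (L i) (P i) q" "Q = P(i := q)"
    using assms legal_move_iff by blast
  show "P \<in> positions k L" by fact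
  show "Q \<in> positions k L" using * pond_move_frog_pairs(2)[OF *(3)]
    unfolding positions_def by (auto simp: PiE_iff extensional_def)
qed

text \<open>A move lowers the rank of one pond and leaves the others alone, so the sum of the ranks
  decreases.\<close>

lemma short_game_legal_move:
  assumes short: "\<And>i. i \<in> {1..k} \<Longrightarrow> short_game (pond_move (L i))"
  shows "short_game (legal_move k L)"
proof -
  have "\<exists>f :: _ \<Rightarrow> nat. \<forall>p q. pond_move (L i) p q \<longrightarrow> f q < f p" if "i \<in> {1..k}" for i
    by (rule short_game_rank[OF short[OF that]]) blast
  then obtain f :: "nat \<Rightarrow> _ \<Rightarrow> nat"
    where f: "\<And>i p q. i \<in> {1..k} \<Longrightarrow> pond_move (L i) p q \<Longrightarrow> f i q < f i p"
    by metis
  show ?thesis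
  proof (rule short_gameI[where f = "\<lambda>P. \<Sum>i\<in>{1..k}. f i (P i)"])
    fix P Q assume "legal_move k L P Q"
    then obtain i q where *: "i \<in> {1..k}" "pond_move (L i) (P i) q" "Q = P(i := q)"
      using legal_move_iff by blast
    show "(\<Sum>i\<in>{1..k}. f i (Q i)) < (\<Sum>i\<in>{1..k}. f i (P i))"
    proof (rule sum_strict_mono_ex1)
      show "\<forall>j\<in>{1..k}. f j (Q j) \<le> f j (P j)"
        using f[OF *(1,2)] by (simp add: *(3) less_imp_le)
      show "\<exists>j\<in>{1..k}. f j (Q j) < f j (P j)"
        using f[OF *(1,2)] *(1) by (intro bexI[of _ i]) (simp_all add: *(3))
    qed simp
  next
    fix P
    have "{Q. legal_move k L P Q} \<subseteq> (\<Union>i\<in>{1..k}. (\<lambda>q. P(i := q)) ` {q. pond_move (L i) (P i) q})"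
      by (auto simp: legal_move_iff)
    moreover have "finite {q. pond_move (L i) (P i) q}" if "i \<in> {1..k}" for i
      using short[OF that] unfolding short_game_def by blast
    then have "finite (\<Union>i\<in>{1..k}. (\<lambda>q. P(i := q)) ` {q. pond_move (L i) (P i) q})"
      by (intro finite_UN_I finite_imageI) simp_all
    ultimately show "finite {Q. legal_move k L P Q}" by (rule finite_subset)
  qed
qed

text \<open>The game is regarded as the sum of two games: the first \<open>k - 1\<close> ponds and
  the last pond. For \<open>k = 1\<close> the first summand is the game without ponds, which has no
  moves.\<close>

lemma positions_last_pond:
  assumes "k \<ge> 1"
  shows "P \<in> positions k L \<longleftrightarrow> P \<in> extensional {1..k} \<and>
    restrict P {1..<k} \<in> positions (k - 1) L \<and> P k \<in> frog_pairs (L k)"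
proof -
  have "{1..k - 1} = {1..<k}" "{1..k} = insert k {1..<k}" using assms by auto
  then show ?thesis by (auto simp: positions_def PiE_iff)
qed

lemma legal_move_last_pond:
  assumes "k \<ge> 1" "P \<in> positions k L" "pond_move (L k) (P k) q"
  shows "legal_move k L P (P(k := q))"
  unfolding legal_move_iff using assms by (intro conjI bexI[of _ k] exI[of _ q]) auto

lemma legal_move_first_ponds:
  assumes "k \<ge> 1" "P \<in> positions k L" "legal_move (k - 1) L (restrict P {1..<k}) R"
  obtains Q where "legal_move k L P Q" "restrict Q {1..<k} = R" "Q k = P k"
proof -
  have eq: "{1..k - 1} = {1..<k}" using assms(1) by auto
  obtain i q where *: "i \<in> {1..<k}" "pond_move (L i) (restrict P {1..<k} i) q"
      "R = (restrict P {1..<k})(i := q)"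
    using assms(3) unfolding legal_move_iff eq by blast
  show ?thesis
  proof (rule that[of "P(i := q)"])
    show "legal_move k L P (P(i := q))"
      unfolding legal_move_iff using * assms(1,2)
      by (intro conjI bexI[of _ i] exI[of _ q]) auto
    show "restrict (P(i := q)) {1..<k} = R" "(P(i := q)) k = P k"
      using * by (auto simp: restrict_def fun_eq_iff)
  qed
qed

lemma legal_move_cases:
  assumes "k \<ge> 1" "legal_move k L P Q"
  shows "restrict Q {1..<k} = restrict P {1..<k} \<and> pond_move (L k) (P k) (Q k) \<or>
    legal_move (k - 1) L (restrict P {1..<k}) (restrict Q {1..<k}) \<and> Q k = P k"
proof -
  have eq: "{1..k - 1} = {1..<k}" using assms(1) by auto
  obtain i q where *: "P \<in> positions k L" "i \<in> {1..k}" "pond_move (L i) (P i) q" "Q = P(i := q)"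
    using assms(2) legal_move_iff by blast
  show ?thesis
  proof (cases "i = k")
    case True
    then show ?thesis using * by (auto simp: restrict_def fun_eq_iff)
  next
    case False
    then have i: "i \<in> {1..<k}" using * by auto
    have "legal_move (k - 1) L (restrict P {1..<k}) (restrict Q {1..<k})"
      unfolding legal_move_iff eq
    proof (intro conjI bexI[OF _ i] exI[of _ q])
      show "restrict P {1..<k} \<in> positions (k - 1) L" using *(1) positions_last_pond[OF assms(1)] by blast
    qed (use * i in \<open>auto simp: restrict_def fun_eq_iff\<close>)
    then show ?thesis using * False by simp
  qed
qed

text \<open>Balanced positions are the ones that are lost for the player to move.\<close>

definition balanced :: "nat \<Rightarrow> (nat \<Rightarrow> 'a::metric_space set) \<Rightarrow> 'a position \<Rightarrow> bool" where
  "balanced k L P \<longleftrightarrow>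
     grundy (legal_move (k - 1) L) (restrict P {1..<k}) = grundy (pond_move (L k)) (P k)"

context
  fixes k :: nat and L :: "nat \<Rightarrow> 'a::metric_space set"
  assumes k: "k \<ge> 1" and short: "\<And>i. i \<in> {1..k} \<Longrightarrow> short_game (pond_move (L i))"
begin

lemma short_first: "short_game (legal_move (k - 1) L)"
  by (rule short_game_legal_move) (use short in auto)

lemma short_last: "short_game (pond_move (L k))"
  using short k by simp

text \<open>A move acts in exactly one of the two summands and changes the Grundy value there, so
  equal values become different.\<close>

lemma balanced_move_unbalances:
  assumes "balanced k L P" "legal_move k L P Q"
  shows "\<not> balanced k L Q"
  using legal_move_cases[OF k assms(2)] grundy_step_neq[OF short_first] grundy_step_neq[OF short_last]
    assms(1) unfolding balanced_def by metis

text \<open>The summand with the larger Grundy value has a move down to any smaller value, in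
  particular to that of the other summand.\<close>

lemma unbalanced_can_balance:
  assumes P: "P \<in> positions k L" and "\<not> balanced k L P"
  obtains Q where "legal_move k L P Q" "balanced k L Q"
proof -
  let ?g = "grundy (legal_move (k - 1) L) (restrict P {1..<k})" and ?h = "grundy (pond_move (L k)) (P k)"
  consider "?h < ?g" | "?g < ?h" using assms(2) unfolding balanced_def by linarith
  then show ?thesis
  proof cases
    case 1
    then obtain R where R: "legal_move (k - 1) L (restrict P {1..<k}) R"
      "grundy (legal_move (k - 1) L) R = ?h"
      by (rule grundy_less_obtains[OF short_first])
    obtain Q where "legal_move k L P Q" "restrict Q {1..<k} = R" "Q k = P k"
      using legal_move_first_ponds[OF k P R(1)] .
    then show ?thesis using R that by (simp add: balanced_def)
  next
    case 2
    then obtain q where q: "pond_move (L k) (P k) q" "grundy (pond_move (L k)) q = ?g"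
      by (rule grundy_less_obtains[OF short_last])
    have "restrict (P(k := q)) {1..<k} = restrict P {1..<k}" by (auto simp: restrict_def)
    then show ?thesis
      using that[of "P(k := q)"] legal_move_last_pond[OF k P q(1)] q(2) by (simp add: balanced_def)
  qed
qed

text \<open>The hypothesis \<open>complete\<close> lets Bob's placement produce a balanced position
  whatever the opening was; afterwards he restores the balance after each of Alice's moves.\<close>

lemma Bob_winsI:
  assumes complete: "\<And>x j. x \<in> L k \<Longrightarrow> \<exists>y\<in>L k. y \<noteq> x \<and> grundy (pond_move (L k)) (x, y) = j"
  shows "Bob_wins k L"
proof -
  define b where "b = (\<lambda>(P, x). SOME y. y \<in> L k \<and> y \<noteq> x \<and>
      grundy (pond_move (L k)) (x, y) = grundy (legal_move (k - 1) L) P)"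
  \<comment> \<open>The fallback to an arbitrary legal move is there because \<open>strategy\<close>
    demands one at every position that is not stuck, also where no move leads to balance.\<close>
  define \<beta> where "\<beta> P = (if \<exists>Q. legal_move k L P Q \<and> balanced k L Q
      then SOME Q. legal_move k L P Q \<and> balanced k L Q else SOME Q. legal_move k L P Q)" for P
  have b: "b (P, x) \<in> L k \<and> b (P, x) \<noteq> x \<and>
      grundy (pond_move (L k)) (x, b (P, x)) = grundy (legal_move (k - 1) L) P"
    if "x \<in> L k" for P x
    using someI_ex[OF complete[OF that, of "grundy (legal_move (k - 1) L) P", unfolded Bex_def]]
    by (simp add: b_def)
  have \<beta>_strategy: "strategy k L \<beta>"
    unfolding strategy_def stuck_def
  proof (intro ballI impI)
    fix P assume "\<not> (\<nexists>Q. legal_move k L P Q)"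
    then show "legal_move k L P (\<beta> P)"
      using someI_ex[of "\<lambda>Q. legal_move k L P Q \<and> balanced k L Q"] someI_ex[of "\<lambda>Q. legal_move k L P Q"]
      by (auto simp: \<beta>_def)
  qed
  have \<beta>_balances: "legal_move k L P (\<beta> P) \<and> balanced k L (\<beta> P)"
    if "P \<in> positions k L" "\<not> balanced k L P" for P
    using unbalanced_can_balance[OF that] someI_ex[of "\<lambda>Q. legal_move k L P Q \<and> balanced k L Q"]
    by (auto simp: \<beta>_def)
  have "won_by_Bob k L (play \<alpha> \<beta> (P(k := (x, b (P, x)))))"
    if Px: "(P, x) \<in> openings k L" and \<alpha>: "strategy k L \<alpha>" for P x \<alpha>
  proof -
    define p where "p = play \<alpha> \<beta> (P(k := (x, b (P, x))))"
    have P: "P \<in> (\<Pi>\<^sub>E i\<in>{1..<k}. frog_pairs (L i))" and x: "x \<in> L k"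
      using Px by (auto simp: openings_def)
    have eq: "{1..k - 1} = {1..<k}" and ins: "{1..k} = insert k {1..<k}" using k by auto
    have res: "restrict (P(k := (x, b (P, x)))) {1..<k} = P"
    proof
      fix i show "restrict (P(k := (x, b (P, x)))) {1..<k} i = P i"
        using PiE_arb[OF P, of i] by (cases "i \<in> {1..<k}") auto
    qed
    have p0: "p 0 \<in> positions k L" "balanced k L (p 0)"
    proof -
      show "p 0 \<in> positions k L"
        unfolding positions_last_pond[OF k] p_def play.simps res
      proof (intro conjI)
        show "P(k := (x, b (P, x))) \<in> extensional {1..k}"
          using P unfolding ins by (auto simp: PiE_iff extensional_def)
        show "P \<in> positions (k - 1) L" using P unfolding positions_def eq .
        show "(P(k := (x, b (P, x)))) k \<in> frog_pairs (L k)"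
          using x b[OF x, of P] by (auto simp: frog_pairs_def)
      qed
      show "balanced k L (p 0)"
        unfolding balanced_def p_def play.simps res using b[OF x, of P] by simp
    qed
    have legal: "legal_move k L (p n) (p (Suc n))" if "p n \<in> positions k L" "\<not> stuck k L (p n)" for n
      using that \<alpha> \<beta>_strategy by (auto simp: p_def strategy_def)
    \<comment> \<open>Alice moves at even stages, always from balanced positions.\<close>
    have inv: "p n \<in> positions k L \<and> (even n \<longleftrightarrow> balanced k L (p n))"
      if "\<forall>m<n. \<not> stuck k L (p m)" for n
      using that
    proof (induction n)
      case 0
      then show ?case using p0 by simp
    next
      case (Suc n)
      then have IH: "p n \<in> positions k L" "even n \<longleftrightarrow> balanced k L (p n)" by auto
      have move: "legal_move k L (p n) (p (Suc n))" using legal IH Suc.prems by blast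
      have "p (Suc n) = \<beta> (p n)" if "odd n" using that by (simp add: p_def)
      then show ?case
        using legal_move_positions(2)[OF move] balanced_move_unbalances[OF _ move] \<beta>_balances IH by auto
    qed
    have "\<exists>n. stuck k L (p n)"
    proof (rule ccontr)
      assume "\<nexists>n. stuck k L (p n)"
      then have "\<forall>n. (p (Suc n), p n) \<in> {(Q, P). legal_move k L P Q}" using inv legal by auto
      then show False
        using short_game_legal_move[of k L, OF short] unfolding short_game_def wf_iff_no_infinite_down_chain
        by blast
    qed
    then obtain n where n: "stuck k L (p n)" "\<forall>m<n. \<not> stuck k L (p m)"
      using exists_least_iff[of "\<lambda>n. stuck k L (p n)"] by blast
    \<comment> \<open>At an odd stage the position is unbalanced, so \<open>\<beta>\<close> still
      has a move and play cannot be stuck there.\<close>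
    have "even n"
      using inv[OF n(2)] n(1) \<beta>_balances unfolding stuck_def by blast
    then show ?thesis unfolding won_by_Bob_def p_def[symmetric] using n by blast
  qed
  then show ?thesis unfolding Bob_wins_def using b \<beta>_strategy
    by (intro exI[of _ b] exI[of _ \<beta>]) (auto simp: openings_def)
qed

end

section \<open>The law of a Poisson process\<close>

lemma space_configuration_space [simp]: "space configuration_space = locally_finite_sets"
  and sets_configuration_space: "sets configuration_space = sigma_sets locally_finite_sets
     {{S \<in> locally_finite_sets. card (S \<inter> B) = n} | B n. B \<in> sets borel \<and> bounded B}"
  unfolding configuration_space_def by (auto intro!: space_measure_of sets_measure_of)

lemma measurable_configuration_spaceI:
  fixes X :: "'w \<Rightarrow> 'a::euclidean_space set"
  assumes "\<And>w. w \<in> space M \<Longrightarrow> X w \<in> locally_finite_sets"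
    and "\<And>B n. B \<in> sets borel \<Longrightarrow> bounded B \<Longrightarrow> {w \<in> space M. card (X w \<inter> B) = n} \<in> sets M"
  shows "X \<in> measurable M configuration_space"
  unfolding configuration_space_def
proof (rule measurable_measure_of)
  fix A :: "'a set set" assume "A \<in> {{S \<in> locally_finite_sets. card (S \<inter> B) = n} | B n. B \<in> sets borel \<and> bounded B}"
  then obtain B n where "A = {S \<in> locally_finite_sets. card (S \<inter> B) = n}" "B \<in> sets borel" "bounded B"
    by blast
  moreover from this(1) have "X -` A \<inter> space M = {w \<in> space M. card (X w \<inter> B) = n}"
    using assms(1) by auto
  ultimately show "X -` A \<inter> space M \<in> sets M" using assms(2) by simp
qed (use assms(1) in auto)

lemma measurable_card_Int:
  assumes "B \<in> sets borel" "bounded B"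
  shows "(\<lambda>S. card (S \<inter> B)) \<in> measurable configuration_space (count_space UNIV)"
proof -
  have "(\<lambda>S. card (S \<inter> B)) -` {n} \<inter> space configuration_space \<in> sets configuration_space" for n
    unfolding sets_configuration_space using assms
    by (intro sigma_sets.Basic) (auto intro!: exI[of _ B])
  then show ?thesis by (simp add: measurable_count_space_eq_countable)
qed

lemma poisson_process_measurable:
  "poisson_process M r X \<Longrightarrow> X \<in> measurable M configuration_space"
  by (simp add: poisson_process_def)

lemma poisson_process_measurable_card:
  assumes "poisson_process M r X" "B \<in> sets borel" "bounded B"
  shows "(\<lambda>w. card (X w \<inter> B)) \<in> measurable M (count_space UNIV)"
  using measurable_compose[OF poisson_process_measurable[OF assms(1)] measurable_card_Int[OF assms(2,3)]] .

lemma poisson_process_locally_finite: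
  "poisson_process M r X \<Longrightarrow> w \<in> space M \<Longrightarrow> X w \<in> locally_finite_sets"
  using measurable_space[OF poisson_process_measurable, of M r X w] by simp

lemma poisson_process_indep_vars:
  assumes "poisson_process M r X" "finite J" "disjoint_family_on B J"
    and "\<And>j. j \<in> J \<Longrightarrow> B j \<in> sets borel \<and> bounded (B j)"
  shows "prob_space.indep_vars M (\<lambda>_. count_space UNIV) (\<lambda>j w. card (X w \<inter> B j)) (J :: nat set)"
  using assms(1)[unfolded poisson_process_def, THEN conjunct2, THEN conjunct2, rule_format, of J B] assms(2-4)
  by blast

lemma poisson_process_measure_card:
  assumes "poisson_process M r X" "B \<in> sets borel" "bounded B"
  shows "measure M {w \<in> space M. card (X w \<inter> B) = n} =
    (r * measure lborel B) ^ n / fact n * exp (- (r * measure lborel B))"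
  using assms unfolding poisson_process_def by blast

text \<open>For disjoint sets the counts are independent, so their joint law is the product of the
  marginals, and these are the Poisson weights with the common intensity \<open>r\<close>.\<close>

lemma poisson_process_joint_distr_eq:
  fixes B :: "nat \<Rightarrow> 'a::euclidean_space set"
  assumes "prob_space M" "poisson_process M r X" "prob_space N" "poisson_process N r Y"
    and J: "finite J" "J \<noteq> {}" "disjoint_family_on B J" "\<And>j. j \<in> J \<Longrightarrow> B j \<in> sets borel \<and> bounded (B j)"
  shows "distr M (\<Pi>\<^sub>M j\<in>J. count_space UNIV) (\<lambda>w. \<lambda>j\<in>J. card (X w \<inter> B j)) =
    distr N (\<Pi>\<^sub>M j\<in>J. count_space UNIV) (\<lambda>w. \<lambda>j\<in>J. card (Y w \<inter> B j))"
proof -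
  interpret M: prob_space M by fact
  interpret N: prob_space N by fact
  have indep: "M.indep_vars (\<lambda>_. count_space UNIV) (\<lambda>j w. card (X w \<inter> B j)) J"
      "N.indep_vars (\<lambda>_. count_space UNIV) (\<lambda>j w. card (Y w \<inter> B j)) J"
    using poisson_process_indep_vars[OF assms(2) J(1,3,4)] poisson_process_indep_vars[OF assms(4) J(1,3,4)]
    by auto
  have rv: "(\<lambda>w. card (X w \<inter> B j)) \<in> measurable M (count_space UNIV)"
      "(\<lambda>w. card (Y w \<inter> B j)) \<in> measurable N (count_space UNIV)" if "j \<in> J" for j
    using poisson_process_measurable_card[OF assms(2), of "B j"]
      poisson_process_measurable_card[OF assms(4), of "B j"] J(4)[OF that] by simp_all
  have "distr M (\<Pi>\<^sub>M j\<in>J. count_space UNIV) (\<lambda>w. \<lambda>j\<in>J. card (X w \<inter> B j)) =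
      (\<Pi>\<^sub>M j\<in>J. distr M (count_space UNIV) (\<lambda>w. card (X w \<inter> B j)))"
    using M.indep_vars_iff_distr_eq_PiM'[OF J(2) rv(1)] indep(1) by simp
  also have "\<dots> = (\<Pi>\<^sub>M j\<in>J. distr N (count_space UNIV) (\<lambda>w. card (Y w \<inter> B j)))"
  proof (rule PiM_cong[OF refl])
    fix j assume j: "j \<in> J"
    show "distr M (count_space UNIV) (\<lambda>w. card (X w \<inter> B j)) =
        distr N (count_space UNIV) (\<lambda>w. card (Y w \<inter> B j))"
    proof (rule measure_eqI_countable)
      fix n :: nat
      have "measure M ((\<lambda>w. card (X w \<inter> B j)) -` {n} \<inter> space M) =
          measure N ((\<lambda>w. card (Y w \<inter> B j)) -` {n} \<inter> space N)"
        using poisson_process_measure_card[OF assms(2), of "B j" n]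
          poisson_process_measure_card[OF assms(4), of "B j" n] J(4)[OF j]
        by (simp add: vimage_def Int_def conj_commute)
      then show "emeasure (distr M (count_space UNIV) (\<lambda>w. card (X w \<inter> B j))) {n} =
          emeasure (distr N (count_space UNIV) (\<lambda>w. card (Y w \<inter> B j))) {n}"
        using rv[OF j] by (simp add: emeasure_distr M.emeasure_eq_measure N.emeasure_eq_measure)
    qed auto
  qed
  also have "\<dots> = distr N (\<Pi>\<^sub>M j\<in>J. count_space UNIV) (\<lambda>w. \<lambda>j\<in>J. card (Y w \<inter> B j))"
    using N.indep_vars_iff_distr_eq_PiM'[OF J(2) rv(2)] indep(2) by simp
  finally show ?thesis .
qed

definition count_cylinder :: "('a::euclidean_space set \<times> nat) set \<Rightarrow> 'a set set" where
  "count_cylinder F = {S \<in> locally_finite_sets. \<forall>(B, n)\<in>F. card (S \<inter> B) = n}"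

text \<open>Cylinders prescribing finitely many counts are closed under intersection, which the
  uniqueness theorem for measures requires of a generator.\<close>

lemma sets_configuration_space_cylinders:
  "sets configuration_space = sigma_sets locally_finite_sets
     {count_cylinder F | F. finite F \<and> (\<forall>(B, n)\<in>F. B \<in> sets borel \<and> bounded B)}" (is "_ = sigma_sets _ ?G")
proof (rule antisym)
  show "sets configuration_space \<subseteq> sigma_sets locally_finite_sets ?G"
    unfolding sets_configuration_space
  proof (rule sigma_sets_subseteq)
    show "{{S \<in> locally_finite_sets. card (S \<inter> B) = n} | B n. B \<in> sets borel \<and> bounded B} \<subseteq> ?G"
    proof clarify
      fix B :: "'a set" and n assume "B \<in> sets borel" "bounded B"
      then show "\<exists>F. {S \<in> locally_finite_sets. card (S \<inter> B) = n} = count_cylinder F \<and>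
          finite F \<and> (\<forall>(B, n)\<in>F. B \<in> sets borel \<and> bounded B)"
        by (intro exI[of _ "{(B, n)}"]) (auto simp: count_cylinder_def)
    qed
  qed
  have "count_cylinder F \<in> sets configuration_space"
    if "finite F" "\<forall>(B, n)\<in>F. B \<in> sets borel \<and> bounded B" for F :: "('a set \<times> nat) set"
  proof -
    have "{S \<in> space configuration_space. \<forall>x\<in>F. card (S \<inter> fst x) = snd x} \<in> sets configuration_space"
    proof (rule sets.sets_Collect_finite_All)
      fix x assume "x \<in> F"
      then have [measurable]: "(\<lambda>S. card (S \<inter> fst x)) \<in> measurable configuration_space (count_space UNIV)"
        using that(2) by (intro measurable_card_Int) auto
      show "{S \<in> space configuration_space. card (S \<inter> fst x) = snd x} \<in> sets configuration_space"
        by measurable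
    qed fact
    then show ?thesis by (simp add: count_cylinder_def case_prod_beta)
  qed
  then have "?G \<subseteq> sets configuration_space" by blast
  from sets.sigma_sets_subset[OF this]
  show "sigma_sets locally_finite_sets ?G \<subseteq> sets configuration_space" by simp
qed

text \<open>The counts in \<open>F\<close> are sums of the independent counts in the atoms of the Boolean algebra
  generated by the sets of \<open>F\<close>.\<close>

lemma emeasure_count_cylinder_eq:
  fixes X :: "'w \<Rightarrow> 'a::euclidean_space set" and Y :: "'v \<Rightarrow> 'a set"
  assumes M: "prob_space M" "poisson_process M r X" and N: "prob_space N" "poisson_process N r Y"
    and F: "finite F" "\<forall>(B, n)\<in>F. B \<in> sets borel \<and> bounded B"
  shows "emeasure (distr M configuration_space X) (count_cylinder F) =
    emeasure (distr N configuration_space Y) (count_cylinder F)"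
\<comment> \<open>Without sets in \<open>F\<close> there are no atoms, while the product description
  of the joint law needs a nonempty index set.\<close>
proof (cases "F = {}")
  case True
  then have "count_cylinder F = space configuration_space" by (simp add: count_cylinder_def)
  then show ?thesis
    using prob_space.emeasure_space_1[OF prob_space.prob_space_distr[OF M(1) poisson_process_measurable[OF M(2)]]]
      prob_space.emeasure_space_1[OF prob_space.prob_space_distr[OF N(1) poisson_process_measurable[OF N(2)]]]
    by simp
next
  case False
  define \<B> where "\<B> = fst ` F"
  have \<B>: "finite \<B>" "\<B> \<noteq> {}" "\<And>B. B \<in> \<B> \<Longrightarrow> B \<in> sets borel \<and> bounded B"
    using F False by (auto simp: \<B>_def)
  define atom where "atom T = \<Inter>T - \<Union>(\<B> - T)" for T
  \<comment> \<open>The empty selection is left out, as its atom would be the unbounded complement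
    of all the sets. The others are numbered because \<open>poisson_process\<close> states
    independence for families indexed by naturals.\<close>
  have "finite (Pow \<B> - {{}})" using \<B>(1) by simp
  then obtain e where e: "bij_betw e {0..<card (Pow \<B> - {{}})} (Pow \<B> - {{}})"
    using ex_bij_betw_nat_finite by blast
  define J where "J = {0..<card (Pow \<B> - {{}})}"
  have eJ: "e j \<subseteq> \<B>" "e j \<noteq> {}" if "j \<in> J" for j
    using bij_betwE[OF e] that by (auto simp: J_def)
  have "Pow \<B> - {{}} \<noteq> {}" using \<B>(2) by blast
  then have "card (Pow \<B> - {{}}) > 0"
    using \<open>finite (Pow \<B> - {{}})\<close> unfolding card_gt_0_iff by blast
  then have J: "finite J" "J \<noteq> {}" unfolding J_def by simp_all
  have atom_unique: "T = {B \<in> \<B>. x \<in> B}" if "x \<in> atom T" "T \<subseteq> \<B>" for x T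
    using that by (auto simp: atom_def)
  have disj: "disjoint_family_on (\<lambda>j. atom (e j)) J"
  proof (unfold disjoint_family_on_def, intro ballI impI)
    fix i j assume "i \<in> J" "j \<in> J" "i \<noteq> j"
    then have "e i \<noteq> e j" using e by (auto simp: bij_betw_def inj_on_def J_def)
    then show "atom (e i) \<inter> atom (e j) = {}"
      using atom_unique[OF _ eJ(1)[OF \<open>i \<in> J\<close>]] atom_unique[OF _ eJ(1)[OF \<open>j \<in> J\<close>]] by auto
  qed
  have atom_borel: "atom (e j) \<in> sets borel \<and> bounded (atom (e j))" if j: "j \<in> J" for j
  proof
    have fin: "finite (e j)" "finite (\<B> - e j)" using eJ(1)[OF j] \<B>(1) finite_subset by auto
    have "\<Inter> (e j) \<in> sets borel"
      using sets.finite_INT[of "e j" "\<lambda>B. B" borel] eJ[OF j] \<B>(3) fin(1) by auto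
    moreover have "\<Union> (\<B> - e j) \<in> sets borel"
      by (rule sets.finite_Union[OF fin(2)]) (use \<B>(3) in auto)
    ultimately show "atom (e j) \<in> sets borel" unfolding atom_def by (rule sets.Diff)
    obtain B where "B \<in> e j" using eJ(2)[OF j] by blast
    then have "atom (e j) \<subseteq> B" "bounded B" using eJ(1)[OF j] \<B>(3) by (auto simp: atom_def)
    then show "bounded (atom (e j))" using bounded_subset by blast
  qed
  have card_sum: "card (S \<inter> B) = (\<Sum>j\<in>J. if B \<in> e j then card (S \<inter> atom (e j)) else 0)"
    if S: "S \<in> locally_finite_sets" and B: "B \<in> \<B>" for S B
  proof -
    have "S \<inter> B = (\<Union>j\<in>{j\<in>J. B \<in> e j}. S \<inter> atom (e j))" (is "_ = ?U")
    proof (intro equalityI subsetI)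
      fix x assume x: "x \<in> S \<inter> B"
      define T where "T = {B \<in> \<B>. x \<in> B}"
      have "T \<in> Pow \<B> - {{}}" using x B by (auto simp: T_def)
      then obtain j where "j \<in> J" "e j = T"
        using e unfolding bij_betw_def J_def by (metis imageE)
      moreover have "x \<in> atom T" "B \<in> T" using x B by (auto simp: atom_def T_def)
      ultimately show "x \<in> ?U" using x by blast
    qed (auto simp: atom_def)
    also have "card \<dots> = (\<Sum>j\<in>{j\<in>J. B \<in> e j}. card (S \<inter> atom (e j)))"
    proof (rule card_UN_disjoint)
      show "\<forall>i\<in>{j \<in> J. B \<in> e j}. finite (S \<inter> atom (e i))"
        using S atom_borel by (auto simp: locally_finite_sets_def)
      show "\<forall>i\<in>{j \<in> J. B \<in> e j}. \<forall>j\<in>{j \<in> J. B \<in> e j}. i \<noteq> j \<longrightarrow>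
          (S \<inter> atom (e i)) \<inter> (S \<inter> atom (e j)) = {}"
        using disj unfolding disjoint_family_on_def by blast
    qed (use J in auto)
    also have "\<dots> = (\<Sum>j\<in>J. if B \<in> e j then card (S \<inter> atom (e j)) else 0)"
      using J(1) by (simp add: sum.If_cases Int_def)
    finally show ?thesis .
  qed
  \<comment> \<open>The vectors of atom counts that give the counts prescribed by
    \<open>F\<close>.\<close>
  define G where "G = {c \<in> J \<rightarrow>\<^sub>E (UNIV :: nat set). \<forall>(B, n)\<in>F. (\<Sum>j\<in>J. if B \<in> e j then c j else 0) = n}"
  have G: "G \<in> sets (\<Pi>\<^sub>M j\<in>J. count_space (UNIV :: nat set))"
    by (subst count_space_PiM_finite[OF J(1)]) (auto simp: G_def)
  have key: "emeasure (distr K configuration_space Z) (count_cylinder F) =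
      emeasure (distr K (\<Pi>\<^sub>M j\<in>J. count_space UNIV) (\<lambda>w. \<lambda>j\<in>J. card (Z w \<inter> atom (e j)))) G"
    if Z: "poisson_process K r Z" for K :: "'u measure" and Z
  proof -
    have eq: "Z -` count_cylinder F \<inter> space K =
        (\<lambda>w. \<lambda>j\<in>J. card (Z w \<inter> atom (e j))) -` G \<inter> space K"
    proof -
      have "Z w \<in> count_cylinder F \<longleftrightarrow> (\<lambda>j\<in>J. card (Z w \<inter> atom (e j))) \<in> G" if w: "w \<in> space K" for w
      proof -
        have lf: "Z w \<in> locally_finite_sets" using poisson_process_locally_finite[OF Z w] .
        have "card (Z w \<inter> B) = (\<Sum>j\<in>J. if B \<in> e j then (\<lambda>j\<in>J. card (Z w \<inter> atom (e j))) j else 0)"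
          if "(B, n) \<in> F" for B n
        proof -
          have "B \<in> \<B>" using that by (force simp: \<B>_def)
          show ?thesis unfolding card_sum[OF lf \<open>B \<in> \<B>\<close>] by (rule sum.cong) auto
        qed
        then have "(\<forall>(B, n)\<in>F. card (Z w \<inter> B) = n) \<longleftrightarrow>
            (\<forall>(B, n)\<in>F. (\<Sum>j\<in>J. if B \<in> e j then (\<lambda>j\<in>J. card (Z w \<inter> atom (e j))) j else 0) = n)"
          by (intro ball_cong refl) auto
        then show ?thesis unfolding count_cylinder_def G_def using lf by simp
      qed
      then show ?thesis by auto
    qed
    have cyl: "count_cylinder F \<in> sets configuration_space"
      unfolding sets_configuration_space_cylinders using F by blast
    have "(\<lambda>w. \<lambda>j\<in>J. card (Z w \<inter> atom (e j))) \<in> measurable K (\<Pi>\<^sub>M j\<in>J. count_space UNIV)"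
      by (intro measurable_restrict poisson_process_measurable_card[OF Z]) (use atom_borel in auto)
    then show ?thesis
      using eq G cyl by (simp add: emeasure_distr poisson_process_measurable[OF Z])
  qed
  show ?thesis
    unfolding key[OF M(2)] key[OF N(2)]
    by (subst poisson_process_joint_distr_eq[OF M N J disj]) (use atom_borel in auto)
qed

text \<open>The cylinders form an intersection-stable generator on which the two laws agree; the
  empty prescription \<open>count_cylinder {}\<close> is the whole space.\<close>

lemma poisson_process_distr_unique:
  fixes X :: "'w \<Rightarrow> 'a::euclidean_space set" and Y :: "'v \<Rightarrow> 'a set"
  assumes M: "prob_space M" "poisson_process M r X" and N: "prob_space N" "poisson_process N r Y"
  shows "distr M configuration_space X = distr N configuration_space Y"
proof (rule measure_eqI_generator_eq)
  let ?G = "{count_cylinder F | F. finite F \<and> (\<forall>(B :: 'a set, n)\<in>F. B \<in> sets borel \<and> bounded B)}"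
  show "Int_stable ?G"
  proof (rule Int_stableI)
    fix a b assume "a \<in> ?G" "b \<in> ?G"
    then obtain F F' where *: "a = count_cylinder F" "b = count_cylinder F'" "finite F" "finite F'"
      "\<forall>(B, n)\<in>F. B \<in> sets borel \<and> bounded B" "\<forall>(B, n)\<in>F'. B \<in> sets borel \<and> bounded B"
      by blast
    then have "a \<inter> b = count_cylinder (F \<union> F')"
      unfolding count_cylinder_def ball_Un by auto
    moreover have "finite (F \<union> F')" "\<forall>(B, n)\<in>F \<union> F'. B \<in> sets borel \<and> bounded B"
      unfolding ball_Un using * by blast+
    ultimately show "a \<inter> b \<in> ?G" by blast
  qed
  show "?G \<subseteq> Pow locally_finite_sets" by (auto simp: count_cylinder_def)
  show "emeasure (distr M configuration_space X) A = emeasure (distr N configuration_space Y) A"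
    if "A \<in> ?G" for A
    using that emeasure_count_cylinder_eq[OF M N] by blast
  show "sets (distr M configuration_space X) = sigma_sets locally_finite_sets ?G"
    "sets (distr N configuration_space Y) = sigma_sets locally_finite_sets ?G"
    by (simp_all add: sets_configuration_space_cylinders)
  have "count_cylinder {} \<in> ?G" by blast
  then show "range (\<lambda>_::nat. count_cylinder {}) \<subseteq> ?G" by blast
  show "(\<Union>i::nat. count_cylinder {}) = locally_finite_sets" by (auto simp: count_cylinder_def)
  have "prob_space (distr M configuration_space X)"
    using prob_space.prob_space_distr[OF M(1) poisson_process_measurable[OF M(2)]] .
  then show "emeasure (distr M configuration_space X) (count_cylinder {}) \<noteq> \<infinity>"
    by (simp add: finite_measure.emeasure_finite prob_space.finite_measure)
qed

section \<open>Translation invariance of the Poisson law\<close>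

lemma translation_Int: "(+) v ` S \<inter> B = (+) v ` (S \<inter> (+) v -` B)"
  for v :: "'a::euclidean_space"
  by auto

lemma card_translation_Int: "card ((+) v ` S \<inter> B) = card (S \<inter> (+) v -` B)"
  for v :: "'a::euclidean_space"
  unfolding translation_Int by (rule card_image) simp

lemma translation_vimage: "(+) v -` B = (+) (- v) ` B"
  for v :: "'a::euclidean_space"
  by (force simp: image_iff)

lemma bounded_translation_vimage: "bounded B \<Longrightarrow> bounded ((+) v -` B)"
  for v :: "'a::euclidean_space"
  unfolding translation_vimage by (rule bounded_translation)

lemma borel_translation_vimage: "B \<in> sets borel \<Longrightarrow> (+) v -` B \<in> sets borel"
  for v :: "'a::euclidean_space"
  using measurable_sets_borel[of "(+) v" borel B] by simp

lemma measure_lborel_translation_vimage: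
  "B \<in> sets borel \<Longrightarrow> measure lborel ((+) v -` B) = measure lborel B"
  for v :: "'a::euclidean_space"
  using measure_distr[of "(+) v" lborel borel B] by (simp add: lborel_distr_plus)

lemma locally_finite_sets_translation:
  "S \<in> locally_finite_sets \<Longrightarrow> (+) v ` S \<in> locally_finite_sets"
  unfolding locally_finite_sets_def by (simp add: translation_Int bounded_translation_vimage)

text \<open>The translated process has as many points in \<open>B\<close> as the original one in the
  preimage of \<open>B\<close>, a set of the same Lebesgue measure; preimages of disjoint sets are
  disjoint.\<close>

lemma poisson_process_translation:
  fixes X :: "'w \<Rightarrow> 'a::euclidean_space set"
  assumes "poisson_process M r X"
  shows "poisson_process M r (\<lambda>w. (+) v ` X w)"
  unfolding poisson_process_def card_translation_Int
proof (intro conjI allI impI)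
  show "(\<lambda>w. (+) v ` X w) \<in> measurable M configuration_space"
  proof (rule measurable_configuration_spaceI)
    fix B :: "'a set" and n assume "B \<in> sets borel" "bounded B"
    then have [measurable]: "(\<lambda>w. card (X w \<inter> (+) v -` B)) \<in> measurable M (count_space UNIV)"
      by (intro poisson_process_measurable_card[OF assms] borel_translation_vimage bounded_translation_vimage)
    show "{w \<in> space M. card ((+) v ` X w \<inter> B) = n} \<in> sets M"
      unfolding card_translation_Int by measurable
  qed (rule locally_finite_sets_translation[OF poisson_process_locally_finite[OF assms]])
next
  fix B :: "'a set" and n assume "B \<in> sets borel \<and> bounded B"
  then have B: "B \<in> sets borel" "bounded B" by auto
  then have "measure M {w \<in> space M. card (X w \<inter> (+) v -` B) = n} =
      (r * measure lborel ((+) v -` B)) ^ n / fact n * exp (- (r * measure lborel ((+) v -` B)))"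
    using poisson_process_measure_card[OF assms borel_translation_vimage bounded_translation_vimage] by blast
  then show "measure M {w \<in> space M. card (X w \<inter> (+) v -` B) = n} =
      (r * measure lborel B) ^ n / fact n * exp (- (r * measure lborel B))"
    unfolding measure_lborel_translation_vimage[OF B(1)] .
next
  fix J :: "nat set" and B :: "nat \<Rightarrow> 'a set"
  assume *: "finite J \<and> disjoint_family_on B J \<and> (\<forall>j\<in>J. B j \<in> sets borel \<and> bounded (B j))"
  then have disj: "disjoint_family_on (\<lambda>j. (+) v -` B j) J"
    unfolding disjoint_family_on_def by blast
  show "prob_space.indep_vars M (\<lambda>_. count_space UNIV) (\<lambda>j w. card (X w \<inter> (+) v -` B j)) J"
    by (rule poisson_process_indep_vars[OF assms])
      (use * disj borel_translation_vimage[of _ v] bounded_translation_vimage[of _ v] in blast)+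
qed

section \<open>Unmatched points\<close>

text \<open>Surjectivity ensures that every option of \<open>f p\<close> comes from an option of
  \<open>p\<close>. The statement holds round by round, hence also in games that are not
  short.\<close>

lemma grundy_approx_iso:
  assumes "surj f" "\<And>p q. step' (f p) (f q) \<longleftrightarrow> step p q"
  shows "grundy_approx step' n (f p) = grundy_approx step n p"
proof (induction n arbitrary: p)
  case (Suc n)
  have "(\<forall>q. step' (f p) q \<longrightarrow> grundy_approx step' n q \<noteq> j) \<longleftrightarrow>
      (\<forall>q. step p q \<longrightarrow> grundy_approx step n q \<noteq> j)" for j
    using assms(2) Suc.IH surjD[OF assms(1)] by metis
  then show ?case by simp
qed simp

text \<open>Exchanging the two frogs is an automorphism of the game. This allows a pair
  \<open>(z, y)\<close> to be read as a pair at \<open>y\<close>.\<close>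

lemma grundy_pond_move_commute: "grundy (pond_move S) (x, y) = grundy (pond_move S) (y, x)"
proof -
  have "pond_move S (prod.swap p) (prod.swap q) \<longleftrightarrow> pond_move S p q" for p q
    by (cases p; cases q) (auto simp: pond_move_def frog_pairs_def dist_commute)
  then have "grundy_approx (pond_move S) n (prod.swap (y, x)) = grundy_approx (pond_move S) n (y, x)" for n
    by (intro grundy_approx_iso) auto
  then show ?thesis unfolding grundy_def by simp
qed

lemma grundy_approx_translation:
  fixes S :: "'a::euclidean_space set"
  shows "grundy_approx (pond_move ((+) v ` S)) n (v + x, v + y) = grundy_approx (pond_move S) n (x, y)"
proof -
  let ?f = "map_prod ((+) v) ((+) v)"
  have "surj ?f" by (intro map_prod_surj) simp_all
  moreover have "pond_move ((+) v ` S) (?f p) (?f q) \<longleftrightarrow> pond_move S p q" for p q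
    by (cases p; cases q) (auto simp: pond_move_def frog_pairs_def)
  ultimately have "grundy_approx (pond_move ((+) v ` S)) n (?f (x, y)) = grundy_approx (pond_move S) n (x, y)"
    by (rule grundy_approx_iso)
  then show ?thesis by simp
qed

text \<open>The approximants, rather than \<open>grundy\<close>, keep this set measurable in \<open>S\<close> even where the
  game is not short and \<open>grundy\<close> is a junk value.\<close>

definition unmatched :: "'a::metric_space set \<Rightarrow> nat \<Rightarrow> 'a set" where
  "unmatched S j = {x \<in> S. \<forall>y\<in>S. y \<noteq> x \<longrightarrow>
     \<not> (\<forall>\<^sub>F n in sequentially. grundy_approx (pond_move S) n (x, y) = j)}"

lemma unmatched_iff:
  assumes "short_game (pond_move S)"
  shows "x \<in> unmatched S j \<longleftrightarrow> x \<in> S \<and> (\<forall>y\<in>S. y \<noteq> x \<longrightarrow> grundy (pond_move S) (x, y) \<noteq> j)"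
proof -
  have "(\<forall>\<^sub>F n in sequentially. grundy_approx (pond_move S) n p = j) \<longleftrightarrow> grundy (pond_move S) p = j" for p
  proof
    assume "grundy (pond_move S) p = j"
    with eventually_grundy_approx[OF assms, of p]
    show "\<forall>\<^sub>F n in sequentially. grundy_approx (pond_move S) n p = j" by simp
  qed (rule grundy_eqI)
  then show ?thesis by (simp add: unmatched_def)
qed

lemma unmatched_translation:
  fixes S :: "'a::euclidean_space set"
  shows "unmatched ((+) v ` S) j = (+) v ` unmatched S j"
  unfolding unmatched_def by (auto simp: grundy_approx_translation)

lemma finite_unmatched:
  fixes S :: "'a::euclidean_space set"
  assumes S: "S \<in> locally_finite_sets" and short: "short_game (pond_move S)"
  shows "finite (unmatched S j)"
proof (cases "unmatched S j = {}")
  case False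
  then obtain x where x: "x \<in> unmatched S j" by blast
  let ?g = "grundy (pond_move S)"
  note iff = unmatched_iff[OF short]
  have less: "?g (x, y) < j" if y: "y \<in> unmatched S j" "y \<noteq> x" for y
  proof (rule ccontr)
    assume "\<not> ?g (x, y) < j"
    then have "j < ?g (x, y)" using x y unfolding iff by (metis linorder_neqE_nat)
    then obtain q where "pond_move S (x, y) q" "?g q = j" by (rule grundy_less_obtains[OF short])
    then obtain z where z: "z \<in> S" "z \<noteq> x" "z \<noteq> y" "?g (z, y) = j \<or> ?g (x, z) = j"
      unfolding pond_move_def by auto
    then show False
      using x y unfolding iff grundy_pond_move_commute[of S z y] by blast
  qed
  \<comment> \<open>Of two pairs at \<open>x\<close> with different lengths the shorter is an option
    of the longer, so their values differ.\<close>
  have same_dist: "dist x y = dist x y'"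
    if "y \<in> S" "y \<noteq> x" "y' \<in> S" "y' \<noteq> x" "?g (x, y) = ?g (x, y')" for y y'
  proof -
    have "\<not> dist x a < dist x b" if "a \<in> S" "a \<noteq> x" "b \<in> S" "b \<noteq> x" "?g (x, a) = ?g (x, b)" for a b
    proof
      assume "dist x a < dist x b"
      moreover have "x \<in> S" using x unfolding iff by blast
      ultimately have "pond_move S (x, b) (x, a)"
        using that by (auto simp: pond_move_def frog_pairs_def)
      then show False using grundy_step_neq[OF short] that(5) by blast
    qed
    from this[of y y'] this[of y' y] show ?thesis using that by force
  qed
  have fin: "finite {y \<in> S. y \<noteq> x \<and> ?g (x, y) = i}" for i
  proof (cases "{y \<in> S. y \<noteq> x \<and> ?g (x, y) = i} = {}")
    case False
    then obtain y where y: "y \<in> S" "y \<noteq> x" "?g (x, y) = i" by auto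
    have "{y \<in> S. y \<noteq> x \<and> ?g (x, y) = i} \<subseteq> S \<inter> cball x (dist x y)"
    proof
      fix y' assume "y' \<in> {y \<in> S. y \<noteq> x \<and> ?g (x, y) = i}"
      then show "y' \<in> S \<inter> cball x (dist x y)" using same_dist[of y' y] y by simp
    qed
    moreover have "finite (S \<inter> cball x (dist x y))"
      using S by (simp add: locally_finite_sets_def)
    ultimately show ?thesis by (rule finite_subset)
  qed (simp only: finite.emptyI)
  \<comment> \<open>Every unmatched point other than \<open>x\<close> is sorted by the value, below
    \<open>j\<close>, of its pair with \<open>x\<close>; each class lies on one sphere about
    \<open>x\<close>.\<close>
  have "unmatched S j \<subseteq> insert x (\<Union>i<j. {y \<in> S. y \<noteq> x \<and> ?g (x, y) = i})"
    using less unfolding unmatched_def by blast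
  moreover have "finite (insert x (\<Union>i<j. {y \<in> S. y \<noteq> x \<and> ?g (x, y) = i}))"
    using fin by simp
  ultimately show ?thesis by (rule finite_subset)
qed simp

section \<open>Measurability of the unmatched points\<close>

text \<open>The points of a configuration are addressed by the members of a countable family of sets that
  isolate them, which turns quantifiers over the configuration into countable ones.\<close>

lemma isolating_family:
  obtains b :: "nat \<Rightarrow> 'a::euclidean_space set"
  where "\<And>i. b i \<in> sets borel" "\<And>i. bounded (b i)"
    "\<And>S x. S \<in> locally_finite_sets \<Longrightarrow> x \<in> S \<Longrightarrow> \<exists>i. S \<inter> b i = {x}"
proof -
  obtain D :: "'a set" where D: "countable D" "\<And>U. open U \<Longrightarrow> U \<noteq> {} \<Longrightarrow> \<exists>d\<in>D. d \<in> U"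
    by (rule countable_dense_setE) blast
  define C where "C = (\<lambda>(d, n). ball d (inverse (real (Suc n)))) ` (D \<times> UNIV)"
  have "D \<noteq> {}" using D(2)[of UNIV] by auto
  then have C: "countable C" "C \<noteq> {}" using D(1) by (auto simp: C_def)
  have range: "range (from_nat_into C) = C" using C by (rule range_from_nat_into[rotated])
  show ?thesis
  proof (rule that[of "from_nat_into C"])
    fix i
    have "from_nat_into C i \<in> C" using C(2) by (rule from_nat_into)
    then show "from_nat_into C i \<in> sets borel" "bounded (from_nat_into C i)"
      by (auto simp: C_def)
  next
    fix S :: "'a set" and x assume S: "S \<in> locally_finite_sets" "x \<in> S"
    have "finite (S \<inter> ball x 1)" using S(1) bounded_ball unfolding locally_finite_sets_def by blast
    then obtain e where e: "e > 0" "\<forall>y\<in>S \<inter> ball x 1. y \<noteq> x \<longrightarrow> e \<le> dist x y"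
      using finite_set_avoid by blast
    obtain n where n: "inverse (real (Suc n)) < min 1 e / 2"
      using reals_Archimedean[of "min 1 e / 2"] e(1) by auto
    obtain d where d: "d \<in> D" "d \<in> ball x (inverse (real (Suc n)))"
      using D(2)[of "ball x (inverse (real (Suc n)))"] by auto
    \<comment> \<open>The ball contains \<open>x\<close>, and its radius is below half of
      \<open>min 1 e\<close>, so any other point of \<open>S\<close> in it would be too close to
      \<open>x\<close>.\<close>
    have "S \<inter> ball d (inverse (real (Suc n))) = {x}"
    proof (intro equalityI subsetI)
      fix y assume y: "y \<in> S \<inter> ball d (inverse (real (Suc n)))"
      have "dist x y < min 1 e"
        using dist_triangle[of x y d] d(2) y n by (simp add: dist_commute)
      then show "y \<in> {x}" using e(2) y by force
    qed (use S d in \<open>auto simp: dist_commute\<close>)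
    moreover have "ball d (inverse (real (Suc n))) \<in> C" using d(1) by (auto simp: C_def)
    ultimately show "\<exists>i. S \<inter> from_nat_into C i = {x}" using range by (metis imageE)
  qed
qed

text \<open>The default \<open>0\<close> makes the map total and hence a random point of the space;
  it may happen to be a point of \<open>S\<close>, so the condition
  \<open>card (S \<inter> B) = 1\<close> is carried along where it matters.\<close>

definition isolated_point :: "'a::euclidean_space set \<Rightarrow> 'a set \<Rightarrow> 'a" where
  "isolated_point B S = (if card (S \<inter> B) = 1 then the_elem (S \<inter> B) else 0)"

lemma isolated_point_eq: "S \<inter> B = {x} \<Longrightarrow> isolated_point B S = x"
  by (simp add: isolated_point_def)

lemma isolated_point_mem:
  assumes "card (S \<inter> B) = 1" shows "isolated_point B S \<in> S" "isolated_point B S \<in> B"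
proof -
  obtain x where "S \<inter> B = {x}" using assms by (rule card_1_singletonE)
  then show "isolated_point B S \<in> S" "isolated_point B S \<in> B" using isolated_point_eq[of S B x] by auto
qed

lemma measurable_isolated_point:
  assumes B: "B \<in> sets borel" "bounded B"
  shows "isolated_point B \<in> measurable configuration_space borel"
proof (rule measurableI)
  fix C :: "'a set" assume C: "C \<in> sets borel"
  have BC: "B \<inter> C \<in> sets borel" "bounded (B \<inter> C)"
    using B C by (auto intro: bounded_subset[of B])
  note [measurable] = measurable_card_Int[OF B] measurable_card_Int[OF BC]
  \<comment> \<open>Whether the isolated point lies in \<open>C\<close> is read off from the counts
    in \<open>B\<close> and \<open>B \<inter> C\<close>.\<close>
  have "isolated_point B S \<in> C \<longleftrightarrow> (if card (S \<inter> B) = 1 then card (S \<inter> (B \<inter> C)) = 1 else 0 \<in> C)" for S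
  proof (cases "card (S \<inter> B) = 1")
    case True
    then obtain x where x: "S \<inter> B = {x}" by (rule card_1_singletonE)
    then have "S \<inter> (B \<inter> C) = (if x \<in> C then {x} else {})" by auto
    then show ?thesis using True isolated_point_eq[OF x] by simp
  qed (simp add: isolated_point_def)
  then have "isolated_point B -` C \<inter> space configuration_space = {S \<in> space configuration_space.
      if card (S \<inter> B) = 1 then card (S \<inter> (B \<inter> C)) = 1 else 0 \<in> C}"
    by auto
  also have "\<dots> \<in> sets configuration_space" by measurable
  finally show "isolated_point B -` C \<inter> space configuration_space \<in> sets configuration_space" .
qed simp

context
  fixes b :: "nat \<Rightarrow> 'a::euclidean_space set"
  assumes b: "\<And>i. b i \<in> sets borel" "\<And>i. bounded (b i)"
    and isolating: "\<And>S x. S \<in> locally_finite_sets \<Longrightarrow> x \<in> S \<Longrightarrow> \<exists>i. S \<inter> b i = {x}"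
begin

lemma ball_isolated_point_iff:
  assumes "S \<in> locally_finite_sets"
  shows "(\<forall>x\<in>S. P x) \<longleftrightarrow> (\<forall>i. card (S \<inter> b i) = 1 \<longrightarrow> P (isolated_point (b i) S))"
proof (intro iffI ballI allI impI)
  fix x assume *: "\<forall>i. card (S \<inter> b i) = 1 \<longrightarrow> P (isolated_point (b i) S)" "x \<in> S"
  obtain i where i: "S \<inter> b i = {x}" using isolating[OF assms *(2)] by blast
  then have "card (S \<inter> b i) = 1" by simp
  with * have "P (isolated_point (b i) S)" by blast
  then show "P x" using isolated_point_eq[OF i] by simp
next
  fix i assume "\<forall>x\<in>S. P x" "card (S \<inter> b i) = 1"
  then show "P (isolated_point (b i) S)" using isolated_point_mem(1)[of S "b i"] by blast
qed

lemma bex_isolated_point_iff: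
  assumes "S \<in> locally_finite_sets"
  shows "(\<exists>x\<in>S. P x) \<longleftrightarrow> (\<exists>i. card (S \<inter> b i) = 1 \<and> P (isolated_point (b i) S))"
  using ball_isolated_point_iff[OF assms, of "\<lambda>x. \<not> P x"] by blast

lemma measurable_card_b [measurable]:
  "(\<lambda>S. card (S \<inter> b i)) \<in> measurable configuration_space (count_space UNIV)"
  by (rule measurable_card_Int[OF b])

lemma measurable_isolated_point_b [measurable]:
  "(\<lambda>S. isolated_point (b i) S) \<in> measurable configuration_space borel"
  using measurable_isolated_point[OF b] .

text \<open>The second alternative covers the default value \<open>0\<close> when it belongs to
  \<open>S\<close>. Both sides of the disjunction are statements about counts.\<close>

lemma isolated_point_in_iff:
  "isolated_point B S \<in> S \<longleftrightarrow> card (S \<inter> B) = 1 \<or> card (S \<inter> {0}) = 1"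
proof (cases "card (S \<inter> B) = 1")
  case False
  then show ?thesis by (cases "0 \<in> S") (auto simp: isolated_point_def)
qed (simp add: isolated_point_mem)

lemma pred_isolated_point_in [measurable]:
  "Measurable.pred configuration_space (\<lambda>S. isolated_point (b i) S \<in> S)"
proof -
  have [measurable]: "(\<lambda>S. card (S \<inter> {0 :: 'a})) \<in> measurable configuration_space (count_space UNIV)"
    by (rule measurable_card_Int) auto
  show ?thesis unfolding isolated_point_in_iff by measurable
qed

lemma pred_isolated_points_neq [measurable]:
  "Measurable.pred configuration_space (\<lambda>S. isolated_point (b i) S \<noteq> isolated_point (b j) S)"
proof -
  have "Measurable.pred configuration_space
      (\<lambda>S. dist (isolated_point (b i) S) (isolated_point (b j) S) \<noteq> 0)"
    by measurable
  then show ?thesis by simp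
qed

text \<open>One round of the mex rule quantifies over the points \<open>z\<close> of
  \<open>S\<close>. Running through the isolating sets instead gives a countable quantifier, and
  \<open>LEAST\<close> of measurable predicates is measurable.\<close>

lemma measurable_grundy_approx_isolated_points [measurable]:
  "(\<lambda>S. grundy_approx (pond_move S) n (isolated_point (b i) S, isolated_point (b j) S))
     \<in> measurable configuration_space (count_space UNIV)"
proof (induction n arbitrary: i j)
  case (Suc n)
  note [measurable] = Suc.IH
  let ?p = "\<lambda>i S. isolated_point (b i) S"
  let ?G = "\<lambda>S :: 'a set. grundy_approx (pond_move S) n"
  have "(\<lambda>S. LEAST m. ?p i S \<in> S \<and> ?p j S \<in> S \<and> ?p i S \<noteq> ?p j S \<longrightarrow>
      (\<forall>l. card (S \<inter> b l) = 1 \<longrightarrow> ?p l S \<noteq> ?p i S \<and> ?p l S \<noteq> ?p j S \<longrightarrow>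
        (dist (?p l S) (?p j S) < dist (?p i S) (?p j S) \<longrightarrow> ?G S (?p l S, ?p j S) \<noteq> m) \<and>
        (dist (?p i S) (?p l S) < dist (?p i S) (?p j S) \<longrightarrow> ?G S (?p i S, ?p l S) \<noteq> m)))
    \<in> measurable configuration_space (count_space UNIV)" (is "?f \<in> _")
    by measurable
  also have "?f \<in> measurable configuration_space (count_space UNIV) \<longleftrightarrow> ?case"
  proof (rule measurable_cong)
    fix S :: "'a set" assume "S \<in> space configuration_space"
    then have S: "S \<in> locally_finite_sets" by simp
    have "(\<forall>q. pond_move S (?p i S, ?p j S) q \<longrightarrow> ?G S q \<noteq> m) \<longleftrightarrow>
      (?p i S \<in> S \<and> ?p j S \<in> S \<and> ?p i S \<noteq> ?p j S \<longrightarrow>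
        (\<forall>z\<in>S. z \<noteq> ?p i S \<and> z \<noteq> ?p j S \<longrightarrow>
        (dist z (?p j S) < dist (?p i S) (?p j S) \<longrightarrow> ?G S (z, ?p j S) \<noteq> m) \<and>
        (dist (?p i S) z < dist (?p i S) (?p j S) \<longrightarrow> ?G S (?p i S, z) \<noteq> m)))" for m
      unfolding pond_move_def frog_pairs_def by auto
    then show "?f S = grundy_approx (pond_move S) (Suc n) (?p i S, ?p j S)"
      unfolding ball_isolated_point_iff[OF S] by simp
  qed
  finally show ?case .
qed simp

lemma sets_unmatched_meets_b:
  fixes B :: "'a set"
  assumes [measurable]: "B \<in> sets borel"
  shows "{S \<in> space configuration_space. unmatched S j \<inter> B \<noteq> {}} \<in> sets configuration_space"
proof -
  let ?p = "\<lambda>i S. isolated_point (b i) S"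
  let ?G = "\<lambda>S :: 'a set. grundy_approx (pond_move S)"
  \<comment> \<open>The quantifiers over points become quantifiers over indices, and the eventual
    statement is unfolded into countable ones as well.\<close>
  have "{S \<in> space configuration_space. \<exists>i. card (S \<inter> b i) = 1 \<and> ?p i S \<in> B \<and>
     (\<forall>l. card (S \<inter> b l) = 1 \<longrightarrow> ?p l S \<noteq> ?p i S \<longrightarrow>
       \<not> (\<exists>N. \<forall>n\<in>{N..}. ?G S n (?p i S, ?p l S) = j))} \<in> sets configuration_space"
    by measurable
  also have "?this \<longleftrightarrow> ?thesis"
  proof (rule arg_cong[where f = "\<lambda>A. A \<in> _"], rule Collect_cong, rule conj_cong[OF refl])
    fix S :: "'a set" assume "S \<in> space configuration_space"
    then have S: "S \<in> locally_finite_sets" by simp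
    have "unmatched S j \<inter> B \<noteq> {} \<longleftrightarrow> (\<exists>x\<in>S. x \<in> B \<and> (\<forall>y\<in>S. y \<noteq> x \<longrightarrow>
        \<not> (\<exists>N. \<forall>n\<in>{N..}. ?G S n (x, y) = j)))"
      unfolding unmatched_def eventually_sequentially Ball_def atLeast_iff by blast
    then show "(\<exists>i. card (S \<inter> b i) = 1 \<and> ?p i S \<in> B \<and>
     (\<forall>l. card (S \<inter> b l) = 1 \<longrightarrow> ?p l S \<noteq> ?p i S \<longrightarrow>
       \<not> (\<exists>N. \<forall>n\<in>{N..}. ?G S n (?p i S, ?p l S) = j))) \<longleftrightarrow> unmatched S j \<inter> B \<noteq> {}"
      unfolding ball_isolated_point_iff[OF S] bex_isolated_point_iff[OF S] by simp
  qed
  finally show ?thesis .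
qed

end

lemma sets_unmatched_meets:
  fixes B :: "'a::euclidean_space set"
  assumes "B \<in> sets borel"
  shows "{S \<in> space configuration_space. unmatched S j \<inter> B \<noteq> {}} \<in> sets configuration_space"
proof (rule isolating_family)
  fix b :: "nat \<Rightarrow> 'a set"
  assume "\<And>i. b i \<in> sets borel" "\<And>i. bounded (b i)"
    "\<And>S x. S \<in> locally_finite_sets \<Longrightarrow> x \<in> S \<Longrightarrow> \<exists>i. S \<inter> b i = {x}"
  then show ?thesis by (rule sets_unmatched_meets_b[OF _ _ _ assms])
qed

lemma AE_unmatched_empty:
  fixes X :: "'w \<Rightarrow> 'a::euclidean_space set"
  assumes M: "prob_space M" and X: "poisson_process M r X"
    and short: "AE w in M. short_game (pond_move (X w))"
  shows "AE w in M. unmatched (X w) j = {}"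
proof -
  interpret prob_space M by fact
  obtain e :: 'a where e: "norm e = 1" using norm_Basis SOME_Basis by blast
  \<comment> \<open>Balls of integer radius about the origin exhaust the space, so countably many
    null events suffice.\<close>
  have "AE w in M. unmatched (X w) j \<inter> cball 0 (real R) = {}" for R :: nat
  proof -
    define A :: "nat \<Rightarrow> 'a set set" where
      "A m = {S \<in> space configuration_space. unmatched S j \<inter> cball (real m *\<^sub>R e) (real R) \<noteq> {}}" for m
    have A_iff: "S \<in> A m \<longleftrightarrow> S \<in> locally_finite_sets \<and>
        (\<exists>x\<in>unmatched S j. x \<in> cball (real m *\<^sub>R e) (real R))" for S m
      unfolding A_def by auto
    have A: "A m \<in> sets configuration_space" for m
      unfolding A_def by (rule sets_unmatched_meets) simp
    define E where "E m = X -` A m \<inter> space M" for m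
    have E [measurable]: "E m \<in> sets M" for m
      unfolding E_def by (rule measurable_sets[OF poisson_process_measurable[OF X] A])
    \<comment> \<open>Translation by \<open>?v\<close> carries the ball at
      \<open>real m *\<^sub>R e\<close> to the origin, carries unmatched points to unmatched points,
      and preserves the law.\<close>
    have shift: "prob (E m) = prob (E 0)" for m
    proof -
      let ?v = "- (real m *\<^sub>R e)"
      note Y = poisson_process_translation[OF X, of ?v]
      have "E m = (\<lambda>w. (+) ?v ` X w) -` A 0 \<inter> space M"
      proof -
        have "X w \<in> A m \<longleftrightarrow> (+) ?v ` X w \<in> A 0" if w: "w \<in> space M" for w
        proof -
          have "(\<exists>x\<in>unmatched (X w) j. x \<in> cball (real m *\<^sub>R e) (real R)) \<longleftrightarrow>
              (\<exists>x\<in>(+) ?v ` unmatched (X w) j. x \<in> cball (real 0 *\<^sub>R e) (real R))"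
            by (simp add: dist_norm norm_minus_commute)
          then show ?thesis
            using poisson_process_locally_finite[OF X w] poisson_process_locally_finite[OF Y w]
            unfolding A_iff unmatched_translation by blast
        qed
        then show ?thesis by (auto simp: E_def)
      qed
      then have "prob (E m) = measure (distr M configuration_space (\<lambda>w. (+) ?v ` X w)) (A 0)"
        using measure_distr[OF poisson_process_measurable[OF Y] A] by simp
      also have "\<dots> = measure (distr M configuration_space X) (A 0)"
        using poisson_process_distr_unique[OF M Y M X] by simp
      also have "\<dots> = prob (E 0)"
        using measure_distr[OF poisson_process_measurable[OF X] A] by (simp add: E_def)
      finally show ?thesis .
    qed
    \<comment> \<open>Almost surely the unmatched points are bounded, so the balls moving off in
      direction \<open>e\<close> eventually miss them. The probabilities thus tend to 0, but by
      \<open>shift\<close> they are constant.\<close>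
    have "(\<lambda>m. \<integral>w. indicator (E m) w \<partial>M) \<longlonglongrightarrow> (\<integral>w. (0 :: real) \<partial>M)"
    proof (rule integral_dominated_convergence[where w = "\<lambda>_. 1"])
      show "AE w in M. (\<lambda>m. indicator (E m) w :: real) \<longlonglongrightarrow> 0"
        using short
      proof (rule AE_mp, intro AE_I2 impI)
        fix w assume w: "w \<in> space M" and "short_game (pond_move (X w))"
        then have "finite (unmatched (X w) j)"
          using finite_unmatched poisson_process_locally_finite[OF X w] by blast
        then obtain K where K: "\<forall>x\<in>unmatched (X w) j. norm x \<le> K"
          using finite_imp_bounded bounded_iff by blast
        have "\<forall>\<^sub>F m in sequentially. real m > K + real R"
          using filterlim_real_sequentially unfolding filterlim_at_top_dense by blast
        then have "\<forall>\<^sub>F m in sequentially. indicator (E m) w = (0 :: real)"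
        proof eventually_elim
          case (elim m)
          have "unmatched (X w) j \<inter> cball (real m *\<^sub>R e) (real R) = {}"
          proof (rule ccontr)
            assume "\<not> ?thesis"
            then obtain x where x: "x \<in> unmatched (X w) j" "dist (real m *\<^sub>R e) x \<le> real R" by auto
            have "real m = norm (real m *\<^sub>R e)" using e by simp
            also have "\<dots> \<le> norm x + dist (real m *\<^sub>R e) x"
              unfolding dist_norm by (rule norm_triangle_sub)
            finally show False using x K elim by force
          qed
          then have "w \<notin> E m" by (simp add: E_def A_def)
          then show ?case by simp
        qed
        then show "(\<lambda>m. indicator (E m) w :: real) \<longlonglongrightarrow> 0" by (rule tendsto_eventually)
      qed
    qed (auto intro!: AE_I2 simp: indicator_def)
    then have "(\<lambda>m. prob (E m)) \<longlonglongrightarrow> 0" by simp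
    moreover have "(\<lambda>m. prob (E m)) = (\<lambda>m. prob (E 0))" by (rule ext) (rule shift)
    ultimately have "prob (E 0) = 0" by (simp add: LIMSEQ_const_iff)
    then have "AE w in M. w \<notin> E 0" using prob_eq_0[OF E] by blast
    then show ?thesis
      by (rule AE_mp, intro AE_I2)
        (use poisson_process_locally_finite[OF X] in \<open>auto simp: E_def A_def\<close>)
  qed
  then have "AE w in M. \<forall>R::nat. unmatched (X w) j \<inter> cball 0 (real R) = {}"
    by (simp add: AE_all_countable)
  then show ?thesis
  proof (rule AE_mp, intro AE_I2 impI)
    fix w assume *: "\<forall>R::nat. unmatched (X w) j \<inter> cball 0 (real R) = {}"
    show "unmatched (X w) j = {}"
    proof (rule ccontr)
      assume "unmatched (X w) j \<noteq> {}"
      then obtain x where "x \<in> unmatched (X w) j" by blast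
      moreover obtain R :: nat where "norm x \<le> real R" using real_arch_simple by blast
      ultimately show False using *[rule_format, of R] by (auto simp: dist_norm)
    qed
  qed
qed

section \<open>Absence of infinite descending chains\<close>

text \<open>This is \<open>1 - exp (- t) \<le> t\<close> for the mean count
  \<open>t\<close>.\<close>

lemma poisson_process_prob_occupied_le:
  assumes "prob_space M" and X: "poisson_process M r X" and B: "B \<in> sets borel" "bounded B"
  shows "measure M {w \<in> space M. card (X w \<inter> B) \<noteq> 0} \<le> r * measure lborel B"
proof -
  interpret prob_space M by fact
  have [measurable]: "(\<lambda>w. card (X w \<inter> B)) \<in> measurable M (count_space UNIV)"
    using poisson_process_measurable_card[OF X B] .
  have "prob {w \<in> space M. card (X w \<inter> B) \<noteq> 0} = 1 - prob {w \<in> space M. card (X w \<inter> B) = 0}"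
    by (rule prob_neg) measurable
  also have "\<dots> = 1 - exp (- (r * measure lborel B))"
    using poisson_process_measure_card[OF X B, of 0] by simp
  also have "\<dots> \<le> r * measure lborel B"
    using exp_ge_add_one_self[of "- (r * measure lborel B)"] by linarith
  finally show ?thesis .
qed

text \<open>Disjoint sets have independent counts, so the one-set bounds multiply.\<close>

lemma poisson_process_prob_all_occupied_le:
  fixes B :: "nat \<Rightarrow> 'a::euclidean_space set"
  assumes "prob_space M" and X: "poisson_process M r X"
    and J: "finite J" "J \<noteq> {}" "disjoint_family_on B J"
    and B: "\<And>j. j \<in> J \<Longrightarrow> B j \<in> sets borel \<and> bounded (B j)"
    and q: "\<And>j. j \<in> J \<Longrightarrow> r * measure lborel (B j) \<le> q"
  shows "measure M {w \<in> space M. \<forall>j\<in>J. card (X w \<inter> B j) \<noteq> 0} \<le> q ^ card J"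
proof -
  interpret prob_space M by fact
  have "{w \<in> space M. \<forall>j\<in>J. card (X w \<inter> B j) \<noteq> 0} =
      (\<Inter>j\<in>J. (\<lambda>w. card (X w \<inter> B j)) -` (- {0}) \<inter> space M)"
    using J(2) by auto
  also have "prob \<dots> = (\<Prod>j\<in>J. prob ((\<lambda>w. card (X w \<inter> B j)) -` (- {0}) \<inter> space M))"
    by (rule indep_varsD_finite[OF poisson_process_indep_vars[OF X J(1,3) B] J(2,1)]) auto
  also have "\<dots> = (\<Prod>j\<in>J. prob {w \<in> space M. card (X w \<inter> B j) \<noteq> 0})"
    by (intro prod.cong refl arg_cong[where f = prob]) auto
  also have "\<dots> \<le> (\<Prod>j\<in>J. q)"
  proof (rule prod_mono)
    fix j assume j: "j \<in> J"
    show "0 \<le> prob {w \<in> space M. card (X w \<inter> B j) \<noteq> 0} \<and>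
        prob {w \<in> space M. card (X w \<inter> B j) \<noteq> 0} \<le> q"
      using order_trans[OF poisson_process_prob_occupied_le[OF assms(1) X, of "B j"] q[OF j]] B[OF j]
      by simp
  qed
  finally show ?thesis by simp
qed

section \<open>Discretization by grid cubes\<close>

definition grid_index :: "real \<Rightarrow> real ^ 'd \<Rightarrow> int ^ 'd" where
  "grid_index \<delta> x = (\<chi> i. \<lfloor>x $ i / \<delta>\<rfloor>)"

text \<open>As fibres of \<open>grid_index\<close>, the half-open cubes partition the space and
  distinct ones are disjoint by construction.\<close>

definition grid_cube :: "real \<Rightarrow> int ^ 'd \<Rightarrow> (real ^ 'd) set" where
  "grid_cube \<delta> c = {x. grid_index \<delta> x = c}"

lemma mem_grid_cube:
  assumes "\<delta> > 0"
  shows "x \<in> grid_cube \<delta> c \<longleftrightarrow>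
    (\<forall>i. \<delta> * of_int (c $ i) \<le> x $ i \<and> x $ i < \<delta> * (of_int (c $ i) + 1))"
  using assms
  by (simp add: grid_cube_def grid_index_def vec_eq_iff floor_eq_iff pos_le_divide_eq pos_divide_less_eq
      mult.commute)

lemma borel_grid_cube: "grid_cube \<delta> (c :: int ^ 'd) \<in> sets borel"
proof -
  have "{x \<in> space borel. \<forall>i. \<lfloor>(x :: real ^ 'd) $ i / \<delta>\<rfloor> = c $ i} \<in> sets borel"
    by measurable
  then show ?thesis by (simp add: grid_cube_def grid_index_def vec_eq_iff)
qed

lemma bounded_grid_cube:
  assumes "\<delta> > 0" shows "bounded (grid_cube \<delta> (c :: int ^ 'd))"
proof (rule bounded_subset[OF bounded_cbox])
  show "grid_cube \<delta> c \<subseteq> cbox (\<chi> i. \<delta> * of_int (c $ i)) (\<chi> i. \<delta> * (of_int (c $ i) + 1))"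
    using assms by (auto simp: mem_grid_cube mem_box_cart less_imp_le)
qed

lemma measure_grid_cube:
  assumes "\<delta> > 0"
  shows "measure lborel (grid_cube \<delta> (c :: int ^ 'd)) = measure lborel (grid_cube \<delta> (0 :: int ^ 'd))"
proof -
  have "grid_cube \<delta> c = (+) (\<chi> i. - (\<delta> * of_int (c $ i))) -` grid_cube \<delta> 0"
    using assms by (auto simp: mem_grid_cube algebra_simps)
  then show ?thesis using measure_lborel_translation_vimage[OF borel_grid_cube] by simp
qed

lemma measure_grid_cube_pos:
  assumes \<delta>: "\<delta> > 0"
  shows "measure lborel (grid_cube \<delta> (c :: int ^ 'd)) > 0"
proof -
  have "0 < measure lborel (box 0 ((\<chi> i. \<delta>) :: real ^ 'd))"
    using \<delta> by (subst measure_lborel_box_eq)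
      (auto simp: Basis_vec_def inner_axis intro!: prod_pos split: if_splits)
  also have "\<dots> \<le> measure lborel (grid_cube \<delta> (0 :: int ^ 'd))"
  proof (rule measure_mono_fmeasurable)
    show "box 0 (\<chi> i. \<delta>) \<subseteq> grid_cube \<delta> (0 :: int ^ 'd)"
      using \<delta> by (auto simp: mem_grid_cube mem_box_cart less_imp_le)
    show "grid_cube \<delta> 0 \<in> fmeasurable lborel"
      using borel_grid_cube emeasure_bounded_finite[OF bounded_grid_cube[OF \<delta>]]
      by (intro fmeasurableI) auto
  qed simp
  finally show ?thesis unfolding measure_grid_cube[OF \<delta>, of c] .
qed

text \<open>The possible index differences of two cubes containing points at a distance between
  \<open>u\<close> and \<open>v\<close>: the neighbourhood of a cube in the discretized distance
  graph.\<close>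

definition grid_offsets :: "real \<Rightarrow> real \<Rightarrow> real \<Rightarrow> (int ^ 'd) set" where
  "grid_offsets \<delta> u v = {grid_index \<delta> y - grid_index \<delta> x | x y. u \<le> dist x y \<and> dist x y \<le> v}"

definition shell :: "real \<Rightarrow> real \<Rightarrow> 'a::real_normed_vector set" where
  "shell u v = {x. u \<le> norm x \<and> norm x \<le> v}"

lemma borel_shell: "shell u v \<in> sets (borel :: 'a::euclidean_space measure)"
proof -
  have "{x \<in> space borel. u \<le> norm (x :: 'a) \<and> norm x \<le> v} \<in> sets borel" by measurable
  then show ?thesis by (simp add: shell_def)
qed

lemma fmeasurable_shell: "shell u v \<in> fmeasurable (lborel :: 'a::euclidean_space measure)"
proof (rule fmeasurableI)
  have "shell u v \<subseteq> (cball 0 v :: 'a set)" by (auto simp: shell_def)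
  then have "bounded (shell u v :: 'a set)" using bounded_cball bounded_subset by blast
  then show "emeasure lborel (shell u v :: 'a set) < \<infinity>" by (rule emeasure_bounded_finite)
qed (simp add: borel_shell)

text \<open>In each coordinate, rounding \<open>x\<close> and \<open>y\<close> to their cubes and
  choosing \<open>z\<close> in the cube \<open>c\<close> displaces \<open>y - x\<close> by at most
  \<open>2 * \<delta>\<close>; summing over coordinates bounds the Euclidean error.\<close>

lemma grid_cube_offset_subset_shell:
  assumes \<delta>: "\<delta> > 0" and c: "c \<in> grid_offsets \<delta> u v"
  shows "grid_cube \<delta> (c :: int ^ 'd) \<subseteq> shell (u - 2 * \<delta> * CARD('d)) (v + 2 * \<delta> * CARD('d))"
proof
  fix z assume z: "z \<in> grid_cube \<delta> c"
  obtain x y :: "real ^ 'd" where xy: "c = grid_index \<delta> y - grid_index \<delta> x" "u \<le> dist x y" "dist x y \<le> v"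
    using c by (auto simp: grid_offsets_def)
  have x: "x \<in> grid_cube \<delta> (grid_index \<delta> x)" and y: "y \<in> grid_cube \<delta> (grid_index \<delta> y)"
    by (simp_all add: grid_cube_def)
  have "\<bar>(z - (y - x)) $ i\<bar> \<le> 2 * \<delta>" for i
    using x[unfolded mem_grid_cube[OF \<delta>], rule_format, of i]
      y[unfolded mem_grid_cube[OF \<delta>], rule_format, of i]
      z[unfolded mem_grid_cube[OF \<delta>], rule_format, of i] \<delta>
    by (simp add: xy(1) algebra_simps abs_le_iff)
  then have "(\<Sum>i\<in>UNIV. \<bar>(z - (y - x)) $ i\<bar>) \<le> of_nat CARD('d) * (2 * \<delta>)"
    by (intro sum_bounded_above) simp
  then have "norm (z - (y - x)) \<le> 2 * \<delta> * CARD('d)"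
    using norm_le_l1_cart[of "z - (y - x)"] by (simp add: mult.commute)
  moreover have "\<bar>norm z - norm (y - x)\<bar> \<le> norm (z - (y - x))" by (rule norm_triangle_ineq3)
  moreover have "norm (y - x) = dist x y" by (simp add: dist_norm norm_minus_commute)
  ultimately show "z \<in> shell (u - 2 * \<delta> * CARD('d)) (v + 2 * \<delta> * CARD('d))"
    using xy by (simp add: shell_def abs_le_iff)
qed

text \<open>The cubes indexed by offsets are disjoint, have equal volume and lie in the widened
  shell. Comparing volumes for finite sets of offsets also shows that there are only finitely many
  of them.\<close>

lemma grid_offsets_bound:
  assumes \<delta>: "\<delta> > 0" 
  shows "finite (grid_offsets \<delta> u v :: (int ^ 'd) set)"
    and "real (card (grid_offsets \<delta> u v :: (int ^ 'd) set)) * measure lborel (grid_cube \<delta> (0 :: int ^ 'd))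
      \<le> measure lborel (shell (u - 2 * \<delta> * CARD('d)) (v + 2 * \<delta> * CARD('d)) :: (real ^ 'd) set)"
proof -
  let ?D = "grid_offsets \<delta> u v :: (int ^ 'd) set"
  let ?m = "measure lborel (grid_cube \<delta> (0 :: int ^ 'd))"
  let ?S = "shell (u - 2 * \<delta> * CARD('d)) (v + 2 * \<delta> * CARD('d)) :: (real ^ 'd) set"
  have le: "real (card F) * ?m \<le> measure lborel ?S" if F: "finite F" "F \<subseteq> ?D" for F
  proof -
    have "real (card F) * ?m = (\<Sum>c\<in>F. ?m)" by simp
    also have "\<dots> = (\<Sum>c\<in>F. measure lborel (grid_cube \<delta> c))"
      by (rule sum.cong[OF refl measure_grid_cube[OF \<delta>, symmetric]])
    also have "\<dots> = measure lborel (\<Union>c\<in>F. grid_cube \<delta> c)"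
    proof (rule measure_UNION_AE[symmetric])
      show "pairwise (\<lambda>c c'. AE x in lborel. x \<notin> grid_cube \<delta> c \<or> x \<notin> grid_cube \<delta> c') F"
        by (auto simp: pairwise_def grid_cube_def)
      show "grid_cube \<delta> c \<in> fmeasurable lborel" for c :: "int ^ 'd"
        using borel_grid_cube emeasure_bounded_finite[OF bounded_grid_cube[OF \<delta>]]
        by (intro fmeasurableI) auto
    qed (use F in auto)
    also have "\<dots> \<le> measure lborel ?S"
    proof (rule measure_mono_fmeasurable)
      show "(\<Union>c\<in>F. grid_cube \<delta> c) \<subseteq> ?S"
        using F(2) grid_cube_offset_subset_shell[OF \<delta>] by blast
      show "(\<Union>c\<in>F. grid_cube \<delta> c) \<in> sets lborel"
        using F(1) borel_grid_cube by auto
    qed (rule fmeasurable_shell)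
    finally show ?thesis .
  qed
  show fin: "finite ?D"
  proof (rule ccontr)
    assume "infinite ?D"
    moreover obtain n :: nat where n: "measure lborel ?S / ?m < real n" using reals_Archimedean2 by blast
    ultimately obtain F where F: "finite F" "F \<subseteq> ?D" "card F = n"
      using infinite_arbitrarily_large by blast
    have "measure lborel ?S < real n * ?m"
      using n unfolding pos_divide_less_eq[OF measure_grid_cube_pos[OF \<delta>]] .
    then show False using le[OF F(1,2)] unfolding F(3) by linarith
  qed
  show "real (card ?D) * ?m \<le> measure lborel ?S" by (rule le[OF fin order_refl])
qed

section \<open>Lattice paths and occupied clusters\<close>

primrec grid_paths :: "(int ^ 'd) set \<Rightarrow> nat \<Rightarrow> int ^ 'd \<Rightarrow> (int ^ 'd) list set" where
  "grid_paths D 0 c = {[c]}"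
| "grid_paths D (Suc n) c = (\<Union>u\<in>D. (#) c ` grid_paths D n (c + u))"

lemma finite_grid_paths: "finite D \<Longrightarrow> finite (grid_paths D n c)"
  by (induction n arbitrary: c) auto

lemma card_grid_paths_le: "finite D \<Longrightarrow> card (grid_paths D n c) \<le> card D ^ n"
proof (induction n arbitrary: c)
  case (Suc n)
  have "card (grid_paths D (Suc n) c) \<le> (\<Sum>u\<in>D. card ((#) c ` grid_paths D n (c + u)))"
    using card_UN_le[OF Suc.prems] by simp
  also have "\<dots> \<le> (\<Sum>u\<in>D. card D ^ n)"
    using Suc by (intro sum_mono) (simp add: card_image)
  finally show ?case by simp
qed simp

lemma length_grid_paths: "cs \<in> grid_paths D n c \<Longrightarrow> length cs = Suc n"
  by (induction n arbitrary: c cs) auto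

text \<open>The list of an \<open>rtrancl_path\<close> omits its starting point, whereas
  \<open>grid_paths\<close> includes it; hence the \<open>c #\<close>.\<close>

lemma rtrancl_path_grid_paths:
  assumes "rtrancl_path R c cs c'" "\<And>a b. R a b \<Longrightarrow> b - a \<in> D" "n \<le> length cs"
  shows "c # take n cs \<in> grid_paths D n c"
  using assms
proof (induction arbitrary: n rule: rtrancl_path.induct)
  case (step x y ys z)
  show ?case
  proof (cases n)
    case (Suc m)
    then have "y # take m ys \<in> grid_paths D m (x + (y - x))" using step by simp
    then show ?thesis using step.hyps(1) step.prems(1) Suc by (auto intro!: bexI[of _ "y - x"])
  qed simp
qed simp

text \<open>Occupation is expressed by nonzero counts, the random variables that a Poisson process
  controls.\<close>

definition occupied_adjacent :: "real \<Rightarrow> (int ^ 'd) set \<Rightarrow> (real ^ 'd) set \<Rightarrow> int ^ 'd \<Rightarrow> int ^ 'd \<Rightarrow> bool" where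
  "occupied_adjacent \<delta> D S a b \<longleftrightarrow>
     b - a \<in> D \<and> card (S \<inter> grid_cube \<delta> a) \<noteq> 0 \<and> card (S \<inter> grid_cube \<delta> b) \<noteq> 0"

text \<open>Paths of at most \<open>n\<close> steps reach only finitely many cubes, so some cube of
  an infinite cluster needs more. A path to it without repetitions, cut after \<open>n\<close>
  steps, is the required one.\<close>

lemma long_occupied_path:
  assumes D: "finite D" and inf: "infinite {c'. (occupied_adjacent \<delta> D S)\<^sup>*\<^sup>* c c'}"
  shows "\<exists>cs\<in>grid_paths D n c. distinct cs \<and> (\<forall>a\<in>set cs. card (S \<inter> grid_cube \<delta> a) \<noteq> 0)"
proof -
  let ?R = "occupied_adjacent \<delta> D S"
  have offset: "b - a \<in> D" if "?R a b" for a b using that by (simp add: occupied_adjacent_def)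
  have "finite (\<Union>m\<le>n. last ` grid_paths D m c)" using finite_grid_paths[OF D] by simp
  then have "infinite ({c'. ?R\<^sup>*\<^sup>* c c'} - (\<Union>m\<le>n. last ` grid_paths D m c))" using inf by simp
  from infinite_imp_nonempty[OF this]
  obtain c' where c': "?R\<^sup>*\<^sup>* c c'" "c' \<notin> (\<Union>m\<le>n. last ` grid_paths D m c)"
    by blast
  obtain xs where "rtrancl_path ?R c xs c'" using c'(1) rtranclp_eq_rtrancl_path by metis
  then obtain cs where cs: "rtrancl_path ?R c cs c'" "distinct (c # cs)" by (rule rtrancl_path_distinct)
  have "n < length cs"
  proof (rule ccontr)
    assume short: "\<not> n < length cs"
    have "last (c # cs) = c'"
    proof (cases "cs = []")
      case True
      then show ?thesis using cs(1) by (auto elim: rtrancl_path.cases)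
    next
      case False
      then show ?thesis using rtrancl_path_last[OF cs(1)] by simp
    qed
    moreover have "c # cs \<in> grid_paths D (length cs) c"
      using rtrancl_path_grid_paths[OF cs(1) offset, where n = "length cs"] by simp
    ultimately have "c' \<in> last ` grid_paths D (length cs) c" by (metis imageI)
    then show False using c'(2) short by (simp add: not_less)
  qed
  have "c # take n cs \<in> grid_paths D n c"
    using rtrancl_path_grid_paths[OF cs(1) offset] \<open>n < length cs\<close> by simp
  moreover have "distinct (c # take n cs)"
    using cs(2) by (auto dest: in_set_takeD)
  moreover have "card (S \<inter> grid_cube \<delta> a) \<noteq> 0" if "a \<in> set (c # take n cs)" for a
  proof -
    have "cs \<noteq> []" using \<open>n < length cs\<close> by auto
    have "card (S \<inter> grid_cube \<delta> c) \<noteq> 0"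
      using cs(1) \<open>cs \<noteq> []\<close> by (cases rule: rtrancl_path.cases) (auto simp: occupied_adjacent_def)
    moreover have "card (S \<inter> grid_cube \<delta> a) \<noteq> 0" if "a \<in> set cs"
      using rtrancl_path_Range[OF cs(1) that] by (auto simp: occupied_adjacent_def)
    ultimately show ?thesis using that by (auto dest: in_set_takeD)
  qed
  ultimately show ?thesis by blast
qed

text \<open>A first moment bound: distinct cubes are independent, so an occupied self-avoiding path of
  length \<open>n\<close> exists with probability at most \<open>(card D * q) ^ n * q\<close>.\<close>

lemma AE_finite_occupied_cluster:
  fixes X :: "'w \<Rightarrow> (real ^ 'd) set" and c :: "int ^ 'd"
  assumes M: "prob_space M" and X: "poisson_process M r X" and r: "r > 0" and \<delta>: "\<delta> > 0"
    and D: "finite D" and subcritical: "real (card D) * (r * measure lborel (grid_cube \<delta> (0 :: int ^ 'd))) < 1"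
  shows "AE w in M. finite {c'. (occupied_adjacent \<delta> D (X w))\<^sup>*\<^sup>* c c'}"
proof -
  interpret prob_space M by fact
  define q where "q = r * measure lborel (grid_cube \<delta> (0 :: int ^ 'd))"
  have q0: "q \<ge> 0" using r by (simp add: q_def)
  define occ where "occ cs = {w \<in> space M. \<forall>a\<in>set cs. card (X w \<inter> grid_cube \<delta> a) \<noteq> 0}"
    for cs :: "(int ^ 'd) list"
  have [measurable]: "(\<lambda>w. card (X w \<inter> grid_cube \<delta> a)) \<in> measurable M (count_space UNIV)" for a :: "int ^ 'd"
    by (rule poisson_process_measurable_card[OF X borel_grid_cube bounded_grid_cube[OF \<delta>]])
  have occ [measurable]: "occ cs \<in> sets M" for cs
  proof -
    have "{w \<in> space M. \<forall>a\<in>set cs. card (X w \<inter> grid_cube \<delta> a) \<noteq> 0} \<in> sets M"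
      by (rule sets.sets_Collect_finite_All) measurable
    then show ?thesis by (simp add: occ_def)
  qed
  have occ_le: "prob (occ cs) \<le> q ^ length cs" if "distinct cs" "cs \<noteq> []" for cs
  proof -
    have "occ cs = {w \<in> space M. \<forall>j\<in>{..<length cs}. card (X w \<inter> grid_cube \<delta> (cs ! j)) \<noteq> 0}"
      by (auto simp: occ_def all_set_conv_all_nth)
    also have "prob \<dots> \<le> q ^ card {..<length cs}"
    proof (rule poisson_process_prob_all_occupied_le[OF M X])
      show "disjoint_family_on (\<lambda>j. grid_cube \<delta> (cs ! j)) {..<length cs}"
        using that(1) by (auto simp: disjoint_family_on_def grid_cube_def nth_eq_iff_index_eq)
      show "r * measure lborel (grid_cube \<delta> (cs ! j)) \<le> q" for j
        unfolding q_def measure_grid_cube[OF \<delta>, of "cs ! j"] by simp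
    qed (use that borel_grid_cube bounded_grid_cube[OF \<delta>] in auto)
    finally show ?thesis by simp
  qed
  define E where "E n = (\<Union>cs\<in>{cs \<in> grid_paths D n c. distinct cs}. occ cs)" for n
  have fin: "finite {cs \<in> grid_paths D n c. distinct cs}" for n
    using finite_grid_paths[OF D] by simp
  have E [measurable]: "E n \<in> sets M" for n
    unfolding E_def using fin occ by (intro sets.finite_UN) auto
  \<comment> \<open>A path with \<open>n\<close> steps visits \<open>n + 1\<close> cubes, which
    accounts for the extra factor \<open>q\<close>.\<close>
  have E_le: "prob (E n) \<le> (real (card D) * q) ^ n * q" for n
  proof -
    have "prob (E n) \<le> (\<Sum>cs\<in>{cs \<in> grid_paths D n c. distinct cs}. prob (occ cs))"
      unfolding E_def using fin occ by (intro finite_measure_subadditive_finite) auto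
    also have "\<dots> \<le> (\<Sum>cs\<in>{cs \<in> grid_paths D n c. distinct cs}. q ^ Suc n)"
    proof (rule sum_mono)
      fix cs assume "cs \<in> {cs \<in> grid_paths D n c. distinct cs}"
      then have "distinct cs" "length cs = Suc n" using length_grid_paths by auto
      then show "prob (occ cs) \<le> q ^ Suc n" using occ_le[of cs] by force
    qed
    also have "\<dots> = real (card {cs \<in> grid_paths D n c. distinct cs}) * q ^ Suc n" by simp
    also have "\<dots> \<le> real (card D ^ n) * q ^ Suc n"
    proof (rule mult_right_mono)
      have "card {cs \<in> grid_paths D n c. distinct cs} \<le> card (grid_paths D n c)"
        by (rule card_mono[OF finite_grid_paths[OF D]]) auto
      also have "\<dots> \<le> card D ^ n" by (rule card_grid_paths_le[OF D])
      finally show "real (card {cs \<in> grid_paths D n c. distinct cs}) \<le> real (card D ^ n)"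
        by (rule of_nat_mono)
    qed (use q0 in simp)
    also have "\<dots> = (real (card D) * q) ^ n * q" by (simp add: power_mult_distrib)
    finally show ?thesis .
  qed
  have "(\<lambda>n. (real (card D) * q) ^ n * q) \<longlonglongrightarrow> 0 * q"
  proof (rule tendsto_mult[OF LIMSEQ_realpow_zero tendsto_const])
    show "0 \<le> real (card D) * q" using q0 by simp
    show "real (card D) * q < 1" using subcritical by (simp add: q_def)
  qed
  then have lim: "(\<lambda>n. (real (card D) * q) ^ n * q) \<longlonglongrightarrow> 0" by simp
  have "prob (\<Inter>n. E n) \<le> (real (card D) * q) ^ n * q" for n
  proof -
    have "prob (\<Inter>n. E n) \<le> prob (E n)" by (rule finite_measure_mono[OF _ E]) blast
    then show ?thesis using E_le[of n] by linarith
  qed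
  then have "prob (\<Inter>n. E n) \<le> 0" using LIMSEQ_le_const[OF lim] by blast
  then have "prob (\<Inter>n. E n) = 0" by (simp add: measure_le_0_iff)
  then have "emeasure M (\<Inter>n. E n) = 0" unfolding emeasure_eq_measure by simp
  moreover have "(\<Inter>n. E n) \<in> sets M" by measurable
  ultimately have "(\<Inter>n. E n) \<in> null_sets M" by (rule null_setsI)
  then show ?thesis
  \<comment> \<open>Enclosing the exceptional outcomes in a null set avoids having to prove them
    measurable.\<close>
  proof (rule AE_I')
    show "{w \<in> space M. \<not> finite {c'. (occupied_adjacent \<delta> D (X w))\<^sup>*\<^sup>* c c'}} \<subseteq> (\<Inter>n. E n)"
    proof (intro subsetI INT_I)
      fix w n assume "w \<in> {w \<in> space M. \<not> finite {c'. (occupied_adjacent \<delta> D (X w))\<^sup>*\<^sup>* c c'}}"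
      then have w: "w \<in> space M" "infinite {c'. (occupied_adjacent \<delta> D (X w))\<^sup>*\<^sup>* c c'}" by auto
      obtain cs where "cs \<in> grid_paths D n c" "distinct cs"
          "\<forall>a\<in>set cs. card (X w \<inter> grid_cube \<delta> a) \<noteq> 0"
        using long_occupied_path[OF D w(2)] by blast
      then show "w \<in> E n" using w(1) by (auto simp: E_def occ_def)
    qed
  qed
qed

text \<open>The shells shrink to the sphere of radius \<open>l\<close>, which has Lebesgue measure
  0, and their measures are finite, so these converge to 0.\<close>

lemma thin_shell:
  fixes l r :: real
  assumes "r > 0"
  obtains \<eta> where "\<eta> > 0" "r * measure lborel (shell (l - \<eta>) (l + \<eta>) :: 'a::euclidean_space set) < 1"
proof -
  define A where "A n = (shell (l - 1 / real (Suc n)) (l + 1 / real (Suc n)) :: 'a set)" for n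
  have "(\<lambda>n. measure lborel (A n)) \<longlonglongrightarrow> measure lborel (\<Inter>n. A n)"
  proof (rule Lim_measure_decseq)
    show "range A \<subseteq> sets lborel" using borel_shell by (auto simp: A_def)
    show "decseq A"
    proof (rule decseq_SucI)
      fix n
      have "1 / real (Suc (Suc n)) \<le> 1 / real (Suc n)" by (simp add: frac_le)
      then show "A (Suc n) \<subseteq> A n" unfolding A_def shell_def by auto
    qed
    show "emeasure lborel (A n) \<noteq> \<infinity>" for n
      using fmeasurableD2[OF fmeasurable_shell] by (simp add: A_def)
  qed
  moreover have "(\<Inter>n. A n) \<subseteq> sphere 0 l"
  proof
    fix x :: 'a assume x: "x \<in> (\<Inter>n. A n)"
    have "\<bar>norm x - l\<bar> \<le> 1 / real (Suc n)" for n
      using x by (auto simp: A_def shell_def abs_le_iff algebra_simps dest!: spec[of _ n])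
    moreover have "(\<lambda>n. 1 / real (Suc n)) \<longlonglongrightarrow> 0" by (rule LIMSEQ_Suc) (rule lim_1_over_n)
    ultimately have "\<bar>norm x - l\<bar> \<le> 0" using LIMSEQ_le_const by blast
    then show "x \<in> sphere 0 l" by simp
  qed
  then have "measure lborel (\<Inter>n. A n) = 0"
  proof -
    have "sphere (0 :: 'a) l \<in> null_sets lborel"
      using negligible_sphere[of "0 :: 'a" l]
      by (auto simp: null_sets_completion_iff negligible_iff_null_sets negligible_convex_frontier)
    then have "(\<Inter>n. A n) \<in> null_sets lborel"
    proof (rule null_sets_subset)
      show "(\<Inter>n. A n) \<in> sets lborel" unfolding A_def using borel_shell by (intro sets.countable_INT) auto
      show "(\<Inter>n. A n) \<subseteq> sphere 0 l" by fact
    qed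
    then show ?thesis by (rule measure_eq_0_null_sets)
  qed
  ultimately have "(\<lambda>n. r * measure lborel (A n)) \<longlonglongrightarrow> r * 0"
    by (intro tendsto_mult tendsto_const) simp
  then have "\<forall>\<^sub>F n in sequentially. r * measure lborel (A n) < 1"
    by (rule order_tendstoD(2)) simp
  then obtain n where "r * measure lborel (A n) < 1"
    unfolding eventually_sequentially by blast
  then show ?thesis using that[of "1 / real (Suc n)"] by (simp add: A_def)
qed

section \<open>Shortness of the game in a Poisson pond\<close>

lemma finite_pond_moves:
  fixes S :: "'a::euclidean_space set"
  assumes "S \<in> locally_finite_sets"
  shows "finite {q. pond_move S p q}"
proof -
  obtain x y where p: "p = (x, y)" by fastforce
  have "{q. pond_move S p q} \<subseteq>
      (\<lambda>z. (z, y)) ` (S \<inter> cball y (dist x y)) \<union> (\<lambda>z. (x, z)) ` (S \<inter> cball x (dist x y))"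
    unfolding p pond_move_def by (auto simp: dist_commute)
  moreover have "finite (S \<inter> cball z d)" for z d
    using assms by (simp add: locally_finite_sets_def)
  ultimately show ?thesis by (meson finite_UnI finite_imageI finite_subset)
qed

lemma pond_move_dist: "pond_move S p q \<Longrightarrow> dist (fst q) (snd q) < dist (fst p) (snd p)"
  by (auto simp: pond_move_def)

text \<open>The distances along an unending play decrease to a limit \<open>l\<close>, so from some time on
  all of its points lie in a single infinite cluster of cubes joined by distances close to \<open>l\<close>.\<close>

lemma wf_pond_move:
  fixes S :: "(real ^ 'd) set"
  assumes S: "S \<in> locally_finite_sets" and r: "r > 0"
    and clusters: "\<And>\<delta> u v c. \<lbrakk>\<delta> \<in> range (\<lambda>m. 1 / real (Suc m)); u \<in> \<rat>; v \<in> \<rat>;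
        r * measure lborel (shell (u - 2 * \<delta> * CARD('d)) (v + 2 * \<delta> * CARD('d)) :: (real ^ 'd) set) < 1\<rbrakk>
      \<Longrightarrow> finite {c'. (occupied_adjacent \<delta> (grid_offsets \<delta> u v) S)\<^sup>*\<^sup>* c c'}"
  shows "wf {(q, p). pond_move S p q}"
  unfolding wf_iff_no_infinite_down_chain
proof
  assume "\<exists>f. \<forall>i. (f (Suc i), f i) \<in> {(q, p). pond_move S p q}"
  then obtain f where f: "\<And>i. pond_move S (f i) (f (Suc i))" by blast
  define d where "d i = dist (fst (f i)) (snd (f i))" for i
  have d_Suc: "d (Suc i) < d i" for i unfolding d_def by (rule pond_move_dist[OF f])
  then have dec: "decseq d" by (intro decseq_SucI less_imp_le)
  obtain l where l: "d \<longlonglongrightarrow> l" "\<And>i. l \<le> d i"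
    using decseq_convergent[OF dec, of 0] by (auto simp: d_def)
  obtain \<eta> where \<eta>: "\<eta> > 0" "r * measure lborel (shell (l - \<eta>) (l + \<eta>) :: (real ^ 'd) set) < 1"
    using thin_shell[OF r] .
  \<comment> \<open>The rounding error \<open>2 * \<delta> * CARD('d)\<close> uses up one half of
    \<open>\<eta>\<close>, the rational bounds \<open>u\<close> and \<open>v\<close> around
    \<open>l\<close> the other half.\<close>
  obtain m where m: "inverse (real (Suc m)) < \<eta> / (4 * CARD('d))"
    using reals_Archimedean[of "\<eta> / (4 * CARD('d))"] \<eta>(1) by auto
  define \<delta> where "\<delta> = 1 / real (Suc m)"
  have \<delta>: "\<delta> > 0" "2 * \<delta> * CARD('d) < \<eta> / 2"
    using m by (simp_all add: \<delta>_def field_simps)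
  obtain u where u: "u \<in> \<rat>" "l - \<eta> / 2 < u" "u < l"
    using Rats_dense_in_real[of "l - \<eta> / 2" l] \<eta>(1) by auto
  obtain v where v: "v \<in> \<rat>" "l < v" "v < l + \<eta> / 2"
    using Rats_dense_in_real[of l "l + \<eta> / 2"] \<eta>(1) by auto
  let ?S = "shell (u - 2 * \<delta> * CARD('d)) (v + 2 * \<delta> * CARD('d)) :: (real ^ 'd) set"
  have "measure lborel ?S \<le> measure lborel (shell (l - \<eta>) (l + \<eta>) :: (real ^ 'd) set)"
  proof (rule measure_mono_fmeasurable)
    show "?S \<subseteq> shell (l - \<eta>) (l + \<eta>)" using u v \<delta> by (auto simp: shell_def)
  qed (auto intro: fmeasurable_shell simp: borel_shell)
  then have "r * measure lborel ?S \<le> r * measure lborel (shell (l - \<eta>) (l + \<eta>) :: (real ^ 'd) set)"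
    using r by (intro mult_left_mono) auto
  then have small: "r * measure lborel ?S < 1" using \<eta>(2) by linarith
  let ?R = "occupied_adjacent \<delta> (grid_offsets \<delta> u v) S"
  have "\<forall>\<^sub>F i in sequentially. d i < v" using l(1) v(2) by (rule order_tendstoD(2))
  then obtain N where N: "\<And>i. N \<le> i \<Longrightarrow> d i < v" unfolding eventually_sequentially by blast
  define g where "g i = f (i + N)" for i
  have g: "pond_move S (g i) (g (Suc i))" for i using f[of "i + N"] by (simp add: g_def)
  have g_in: "fst (g i) \<in> S" "snd (g i) \<in> S" for i
    using pond_move_frog_pairs(1)[OF g[of i]] by (auto simp: frog_pairs_def)
  have dist_g: "u \<le> dist (fst (g i)) (snd (g i))" "dist (fst (g i)) (snd (g i)) \<le> v" for i
  proof -
    have "d (i + N) = dist (fst (g i)) (snd (g i))" by (simp add: d_def g_def)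
    then show "u \<le> dist (fst (g i)) (snd (g i))" "dist (fst (g i)) (snd (g i)) \<le> v"
      using l(2)[of "i + N"] N[of "i + N"] u(3) by auto
  qed
  have occ: "card (S \<inter> grid_cube \<delta> (grid_index \<delta> x)) \<noteq> 0" if "x \<in> S" for x
  proof -
    have "finite (S \<inter> grid_cube \<delta> (grid_index \<delta> x))"
      using S bounded_grid_cube[OF \<delta>(1)] unfolding locally_finite_sets_def by blast
    moreover have "x \<in> S \<inter> grid_cube \<delta> (grid_index \<delta> x)" using that by (simp add: grid_cube_def)
    ultimately show ?thesis by (metis card_0_eq empty_iff)
  qed
  \<comment> \<open>Both directions are recorded, since the cluster is followed along directed steps
    and either frog may be the one that stays.\<close>
  have adj: "?R (grid_index \<delta> (fst (g i))) (grid_index \<delta> (snd (g i)))"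
      "?R (grid_index \<delta> (snd (g i))) (grid_index \<delta> (fst (g i)))" for i
  proof -
    have "grid_index \<delta> (snd (g i)) - grid_index \<delta> (fst (g i)) \<in> grid_offsets \<delta> u v"
      unfolding grid_offsets_def using dist_g[of i] by blast
    moreover have "grid_index \<delta> (fst (g i)) - grid_index \<delta> (snd (g i)) \<in> grid_offsets \<delta> u v"
      unfolding grid_offsets_def using dist_g[of i] dist_commute[of "fst (g i)" "snd (g i)"] by force
    ultimately show "?R (grid_index \<delta> (fst (g i))) (grid_index \<delta> (snd (g i)))"
      "?R (grid_index \<delta> (snd (g i))) (grid_index \<delta> (fst (g i)))"
      using occ g_in[of i] by (simp_all add: occupied_adjacent_def)
  qed
  define C where "C = {c'. ?R\<^sup>*\<^sup>* (grid_index \<delta> (fst (g 0))) c'}"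
  have closed: "b \<in> C" if "a \<in> C" "?R a b" for a b
    using that unfolding C_def by (simp add: rtranclp.rtrancl_into_rtrancl)
  have in_C: "grid_index \<delta> (fst (g i)) \<in> C \<and> grid_index \<delta> (snd (g i)) \<in> C" for i
  proof (induction i)
    case 0
    have "grid_index \<delta> (fst (g 0)) \<in> C" by (simp add: C_def)
    then show ?case using closed adj(1)[of 0] by blast
  next
    case (Suc i)
    \<comment> \<open>One frog stays in place, so its cube is already in the cluster; the other
      frog's new cube is adjacent to it.\<close>
    have "fst (g (Suc i)) = fst (g i) \<or> snd (g (Suc i)) = snd (g i)"
      using g[of i] by (auto simp: pond_move_def)
    then show ?case using Suc closed adj[of "Suc i"] by metis
  qed
  have "finite C"
    unfolding C_def by (rule clusters[OF _ u(1) v(1) small]) (simp add: \<delta>_def)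
  moreover have "finite (S \<inter> grid_cube \<delta> c)" for c :: "int ^ 'd"
    using S bounded_grid_cube[OF \<delta>(1)] unfolding locally_finite_sets_def by blast
  ultimately have "finite (\<Union>c\<in>C. S \<inter> grid_cube \<delta> c)" by (rule finite_UN_I)
  moreover have "g i \<in> (\<Union>c\<in>C. S \<inter> grid_cube \<delta> c) \<times> (\<Union>c\<in>C. S \<inter> grid_cube \<delta> c)" for i
    using g_in[of i] in_C[of i] by (auto simp: mem_Times_iff grid_cube_def)
  \<comment> \<open>A finite cluster holds finitely many points and hence finitely many pairs, but
    the strictly decreasing distances make all \<open>g i\<close> different.\<close>
  ultimately have "finite (range g)"
    by (meson finite_SigmaI finite_subset image_subsetI)
  moreover have "inj g"
  proof -
    have "strict_mono (\<lambda>i. - d (i + N))"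
      using d_Suc by (intro strict_monoI_Suc) simp
    then have inj: "inj (\<lambda>i. - d (i + N))" by (rule strict_mono_imp_inj_on)
    show ?thesis
    proof (rule injI)
      fix i j assume "g i = g j"
      then have "- d (i + N) = - d (j + N)" by (simp add: d_def g_def)
      then show "i = j" using injD[OF inj] by blast
    qed
  qed
  ultimately show False using finite_imageD infinite_UNIV_nat by blast
qed

text \<open>The limit distance depends on the outcome, so one null set must serve all limits. Cube
  sides \<open>1 / real (Suc m)\<close>, rational bounds and integer indices leave countably many
  cluster events.\<close>

lemma AE_short_game_pond_move:
  fixes X :: "'w \<Rightarrow> (real ^ 'd) set"
  assumes M: "prob_space M" and X: "poisson_process M r X" and r: "r > 0"
  shows "AE w in M. short_game (pond_move (X w))"
proof -
  interpret prob_space M by fact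
  have AE_cluster: "AE w in M.
      r * measure lborel (shell (u - 2 * \<delta> * CARD('d)) (v + 2 * \<delta> * CARD('d)) :: (real ^ 'd) set) < 1 \<longrightarrow>
      finite {c'. (occupied_adjacent \<delta> (grid_offsets \<delta> u v) (X w))\<^sup>*\<^sup>* c c'}"
    if \<delta>: "\<delta> > 0" for \<delta> u v :: real and c :: "int ^ 'd"
  proof (cases "r * measure lborel (shell (u - 2 * \<delta> * CARD('d)) (v + 2 * \<delta> * CARD('d)) :: (real ^ 'd) set) < 1")
    case True
    \<comment> \<open>The mean degree is bounded by \<open>r\<close> times the volume of the widened
      shell, so a shell of mean content below one is subcritical.\<close>
    have "real (card (grid_offsets \<delta> u v :: (int ^ 'd) set)) *
        (r * measure lborel (grid_cube \<delta> (0 :: int ^ 'd))) =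
        r * (real (card (grid_offsets \<delta> u v :: (int ^ 'd) set)) * measure lborel (grid_cube \<delta> (0 :: int ^ 'd)))"
      by simp
    also have "\<dots> \<le> r * measure lborel
        (shell (u - 2 * \<delta> * CARD('d)) (v + 2 * \<delta> * CARD('d)) :: (real ^ 'd) set)"
      using r grid_offsets_bound(2)[OF \<delta>] by (intro mult_left_mono) auto
    also note True
    finally have "AE w in M. finite {c'. (occupied_adjacent \<delta> (grid_offsets \<delta> u v) (X w))\<^sup>*\<^sup>* c c'}"
      by (rule AE_finite_occupied_cluster[OF M X r \<delta> grid_offsets_bound(1)[OF \<delta>]])
    then show ?thesis by (rule AE_mp) simp
  qed simp
  have "AE w in M. \<forall>m :: nat. \<forall>u v :: rat. \<forall>c :: int ^ 'd.
      r * measure lborel (shell (of_rat u - 2 * (1 / real (Suc m)) * CARD('d))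
        (of_rat v + 2 * (1 / real (Suc m)) * CARD('d)) :: (real ^ 'd) set) < 1 \<longrightarrow>
      finite {c'. (occupied_adjacent (1 / real (Suc m))
        (grid_offsets (1 / real (Suc m)) (of_rat u) (of_rat v)) (X w))\<^sup>*\<^sup>* c c'}"
    unfolding AE_all_countable by (intro allI AE_cluster) simp
  then show ?thesis
  proof (rule AE_mp, intro AE_I2 impI)
    fix w assume w: "w \<in> space M" and *: "\<forall>m :: nat. \<forall>u v :: rat. \<forall>c :: int ^ 'd.
      r * measure lborel (shell (of_rat u - 2 * (1 / real (Suc m)) * CARD('d))
        (of_rat v + 2 * (1 / real (Suc m)) * CARD('d)) :: (real ^ 'd) set) < 1 \<longrightarrow>
      finite {c'. (occupied_adjacent (1 / real (Suc m))
        (grid_offsets (1 / real (Suc m)) (of_rat u) (of_rat v)) (X w))\<^sup>*\<^sup>* c c'}"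
    have lf: "X w \<in> locally_finite_sets" using poisson_process_locally_finite[OF X w] .
    have "wf {(q, p). pond_move (X w) p q}"
    proof (rule wf_pond_move[OF lf r])
      fix \<delta> u v :: real and c :: "int ^ 'd"
      assume "\<delta> \<in> range (\<lambda>m. 1 / real (Suc m))" "u \<in> \<rat>" "v \<in> \<rat>"
        and small: "r * measure lborel (shell (u - 2 * \<delta> * CARD('d)) (v + 2 * \<delta> * CARD('d)) :: (real ^ 'd) set) < 1"
      then obtain m u' v' where "\<delta> = 1 / real (Suc m)" "u = of_rat u'" "v = of_rat v'"
        unfolding Rats_def by blast
      then show "finite {c'. (occupied_adjacent \<delta> (grid_offsets \<delta> u v) (X w))\<^sup>*\<^sup>* c c'}"
        using *[rule_format, of u' m v' c] small by simp
    qed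
    then show "short_game (pond_move (X w))"
      using finite_pond_moves[OF lf] by (simp add: short_game_def)
  qed
qed

section \<open>Bob wins\<close>

theorem theorem13:
  fixes M :: "'w measure"
    and k :: nat
    and L :: "nat \<Rightarrow> 'w \<Rightarrow> (real ^ 'd) set"
    and r :: "nat \<Rightarrow> real"
  assumes "prob_space M"
    and "k \<ge> 1"
    and "\<And>i. i \<in> {1..k} \<Longrightarrow> r i > 0"
    and "\<And>i. i \<in> {1..k} \<Longrightarrow> poisson_process M (r i) (L i)"
    and "prob_space.indep_vars M (\<lambda>_. configuration_space) L {1..k}"
  shows "AE w in M. Bob_wins k (\<lambda>i. L i w)"
proof -
  have k: "k \<in> {1..k}" using assms(2) by simp
  have short: "AE w in M. short_game (pond_move (L i w))" if "i \<in> {1..k}" for i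
    by (rule AE_short_game_pond_move[OF assms(1) assms(4)[OF that] assms(3)[OF that]])
  then have all_short: "AE w in M. \<forall>i\<in>{1..k}. short_game (pond_move (L i w))"
    by (intro AE_finite_allI) auto
  \<comment> \<open>Only in the last pond does Bob choose a position, so only there must every value
    be available; countably many \<open>j\<close> give one null set.\<close>
  have "AE w in M. unmatched (L k w) j = {}" for j
    by (rule AE_unmatched_empty[OF assms(1) assms(4)[OF k] short[OF k]])
  then have "AE w in M. \<forall>j. unmatched (L k w) j = {}"
    by (simp add: AE_all_countable)
  with all_short show ?thesis
  proof eventually_elim
    case (elim w)
    show ?case
    proof (rule Bob_winsI[OF assms(2)])
      show "short_game (pond_move (L i w))" if "i \<in> {1..k}" for i
        using elim(1) that by blast
      fix x j assume "x \<in> L k w"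
      moreover have "x \<notin> unmatched (L k w) j" using elim(2) by simp
      moreover have "short_game (pond_move (L k w))" using elim(1) k by blast
      ultimately show "\<exists>y\<in>L k w. y \<noteq> x \<and> grundy (pond_move (L k w)) (x, y) = j"
        using unmatched_iff[of "L k w" x j] by blast
    qed
  qed
qed

end
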